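(* If $T$ is a continuous-logic theory expanding $\mathsf{MLO}$ such that all models of $T$ are weakly o-minimal, then $T$ is distal.
   Context: $\mathsf{MLO}$ is the theory (in a language containing $r$) whose models are exactly complete metric linear orders of diameter $\le 1$: a linear order $\le$ and metric $d$ such that every open ball is order-convex, with $r(x,y)=\inf_{z\le y}d(x,z)$. A model $M$ is weakly o-minimal if the interpretation of every definable predicate with parameters in one variable is a uniform limit of functions in the $\mathbb{R}$-linear span of characteristic functions of order-convex subsets of $M$. Distality is in the usual sense for continuous logic: $T$ is distal if whenever $I_1+a+I_2$ is an indiscernible sequence (with $I_1,I_2$ infinite without endpoints at the cut) and $I_1+I_2$ is indiscernible over a set $B$, then $I_1+a+I_2$ is indiscernible over $B$. *)

theory Defs
  imports "HOL-Analysis.Analysis"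
begin

section \<open>Continuous first-order logic\<close>

text \<open>We use the \<open>[0,1]\<close>-valued presentation with structures of diameter at most 1.  The
  modulus of a symbol \<open>s\<close> maps \<open>\<epsilon> > 0\<close> to \<open>\<Delta> s \<epsilon> > 0\<close>; the metric is a logical symbol.\<close>

record ('f, 'p) cl_lang =
  Funs :: "'f set"
  Preds :: "'p set"
  farity :: "'f \<Rightarrow> nat"
  parity :: "'p \<Rightarrow> nat"
  fmodulus :: "'f \<Rightarrow> real \<Rightarrow> real"
  pmodulus :: "'p \<Rightarrow> real \<Rightarrow> real"

definition is_lang :: "('f, 'p) cl_lang \<Rightarrow> bool" where
  "is_lang L \<longleftrightarrow>
     (\<forall>f\<in>Funs L. \<forall>\<epsilon>>0. fmodulus L f \<epsilon> > 0) \<and> (\<forall>p\<in>Preds L. \<forall>\<epsilon>>0. pmodulus L p \<epsilon> > 0)"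

datatype 'f cl_term = Var nat | Fn 'f "'f cl_term list"

datatype ('f, 'p) cl_fm =
    Pred 'p "'f cl_term list"
  | Dist "'f cl_term" "'f cl_term"
  | Conn "real list \<Rightarrow> real" "('f, 'p) cl_fm list"
  | SupQ nat "('f, 'p) cl_fm"
  | InfQ nat "('f, 'p) cl_fm"

text \<open>The \<open>n\<close>-ary connectives are all continuous functions from \<open>[0,1]^n\<close> to \<open>[0,1]\<close>.
  Continuity is expressed on \<open>[0,1]^\<nat>\<close> with the product topology, for the function that only
  depends on the first \<open>n\<close> coordinates.\<close>

definition connective :: "nat \<Rightarrow> (real list \<Rightarrow> real) \<Rightarrow> bool" where
  "connective n u \<longleftrightarrow>
     (\<forall>xs. length xs = n \<and> set xs \<subseteq> {0..1} \<longrightarrow> u xs \<in> {0..1}) \<and>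
     continuous_on {x :: nat \<Rightarrow> real. range x \<subseteq> {0..1}} (\<lambda>x. u (map x [0..<n]))"

fun wf_term :: "('f, 'p) cl_lang \<Rightarrow> 'f cl_term \<Rightarrow> bool" where
  "wf_term L (Var x) \<longleftrightarrow> True"
| "wf_term L (Fn f ts) \<longleftrightarrow> f \<in> Funs L \<and> length ts = farity L f \<and> (\<forall>t\<in>set ts. wf_term L t)"

fun wf_fm :: "('f, 'p) cl_lang \<Rightarrow> ('f, 'p) cl_fm \<Rightarrow> bool" where
  "wf_fm L (Pred p ts) \<longleftrightarrow> p \<in> Preds L \<and> length ts = parity L p \<and> (\<forall>t\<in>set ts. wf_term L t)"
| "wf_fm L (Dist s t) \<longleftrightarrow> wf_term L s \<and> wf_term L t"
| "wf_fm L (Conn u \<phi>s) \<longleftrightarrow> connective (length \<phi>s) u \<and> (\<forall>\<phi>\<in>set \<phi>s. wf_fm L \<phi>)"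
| "wf_fm L (SupQ x \<phi>) \<longleftrightarrow> wf_fm L \<phi>"
| "wf_fm L (InfQ x \<phi>) \<longleftrightarrow> wf_fm L \<phi>"

fun tvars :: "'f cl_term \<Rightarrow> nat set" where
  "tvars (Var x) = {x}"
| "tvars (Fn f ts) = (\<Union>t\<in>set ts. tvars t)"

fun fvars :: "('f, 'p) cl_fm \<Rightarrow> nat set" where
  "fvars (Pred p ts) = (\<Union>t\<in>set ts. tvars t)"
| "fvars (Dist s t) = tvars s \<union> tvars t"
| "fvars (Conn u \<phi>s) = (\<Union>\<phi>\<in>set \<phi>s. fvars \<phi>)"
| "fvars (SupQ x \<phi>) = fvars \<phi> - {x}"
| "fvars (InfQ x \<phi>) = fvars \<phi> - {x}"

record ('f, 'p, 'm) cl_struct =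
  met :: "'m metric"
  fint :: "'f \<Rightarrow> 'm list \<Rightarrow> 'm"
  pint :: "'p \<Rightarrow> 'm list \<Rightarrow> real"

abbreviation univ :: "('f, 'p, 'm) cl_struct \<Rightarrow> 'm set" where
  "univ M \<equiv> mspace (met M)"

definition tuples :: "('f, 'p, 'm) cl_struct \<Rightarrow> nat \<Rightarrow> 'm list set" where
  "tuples M n = {xs. length xs = n \<and> set xs \<subseteq> univ M}"

definition close_tuples :: "('f, 'p, 'm) cl_struct \<Rightarrow> real \<Rightarrow> 'm list \<Rightarrow> 'm list \<Rightarrow> bool" where
  "close_tuples M \<delta> xs ys \<longleftrightarrow> list_all2 (\<lambda>x y. mdist (met M) x y < \<delta>) xs ys"

definition is_struct :: "('f, 'p) cl_lang \<Rightarrow> ('f, 'p, 'm) cl_struct \<Rightarrow> bool" where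
  "is_struct L M \<longleftrightarrow>
     univ M \<noteq> {} \<and> mcomplete_of (met M) \<and>
     (\<forall>x\<in>univ M. \<forall>y\<in>univ M. mdist (met M) x y \<le> 1) \<and>
     (\<forall>f\<in>Funs L. (\<forall>xs\<in>tuples M (farity L f). fint M f xs \<in> univ M) \<and>
        (\<forall>\<epsilon>>0. \<forall>xs\<in>tuples M (farity L f). \<forall>ys\<in>tuples M (farity L f).
           close_tuples M (fmodulus L f \<epsilon>) xs ys \<longrightarrow>
           mdist (met M) (fint M f xs) (fint M f ys) \<le> \<epsilon>)) \<and>
     (\<forall>p\<in>Preds L. (\<forall>xs\<in>tuples M (parity L p). pint M p xs \<in> {0..1}) \<and>
        (\<forall>\<epsilon>>0. \<forall>xs\<in>tuples M (parity L p). \<forall>ys\<in>tuples M (parity L p).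
           close_tuples M (pmodulus L p \<epsilon>) xs ys \<longrightarrow>
           \<bar>pint M p xs - pint M p ys\<bar> \<le> \<epsilon>))"

fun teval :: "('f, 'p, 'm) cl_struct \<Rightarrow> (nat \<Rightarrow> 'm) \<Rightarrow> 'f cl_term \<Rightarrow> 'm" where
  "teval M e (Var x) = e x"
| "teval M e (Fn f ts) = fint M f (map (teval M e) ts)"

fun feval :: "('f, 'p, 'm) cl_struct \<Rightarrow> (nat \<Rightarrow> 'm) \<Rightarrow> ('f, 'p) cl_fm \<Rightarrow> real" where
  "feval M e (Pred p ts) = pint M p (map (teval M e) ts)"
| "feval M e (Dist s t) = mdist (met M) (teval M e s) (teval M e t)"
| "feval M e (Conn u \<phi>s) = u (map (feval M e) \<phi>s)"
| "feval M e (SupQ x \<phi>) = (SUP m\<in>univ M. feval M (e(x := m)) \<phi>)"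
| "feval M e (InfQ x \<phi>) = (INF m\<in>univ M. feval M (e(x := m)) \<phi>)"

text \<open>\<open>value_at M \<phi> [a\<^sub>0, \<dots>, a\<^sub>k]\<close> is the value of \<open>\<phi>(a\<^sub>0, \<dots>, a\<^sub>k)\<close>; it is only used when
  all free variables of \<open>\<phi>\<close> are among \<open>x\<^sub>0, \<dots>, x\<^sub>k\<close>.\<close>

definition fm_in :: "('f, 'p) cl_lang \<Rightarrow> nat \<Rightarrow> ('f, 'p) cl_fm \<Rightarrow> bool" where
  "fm_in L n \<phi> \<longleftrightarrow> wf_fm L \<phi> \<and> fvars \<phi> \<subseteq> {..<n}"

definition value_at :: "('f, 'p, 'm) cl_struct \<Rightarrow> ('f, 'p) cl_fm \<Rightarrow> 'm list \<Rightarrow> real" where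
  "value_at M \<phi> xs = feval M (\<lambda>i. xs ! i) \<phi>"

text \<open>A theory is a set of sentences \<open>\<phi>\<close>, standing for the closed conditions \<open>\<phi> = 0\<close>.\<close>

definition is_theory :: "('f, 'p) cl_lang \<Rightarrow> ('f, 'p) cl_fm set \<Rightarrow> bool" where
  "is_theory L T \<longleftrightarrow> (\<forall>\<phi>\<in>T. fm_in L 0 \<phi>)"

definition is_model ::
  "('f, 'p) cl_lang \<Rightarrow> ('f, 'p) cl_fm set \<Rightarrow> ('f, 'p, 'm) cl_struct \<Rightarrow> bool" where
  "is_model L T M \<longleftrightarrow> is_struct L M \<and> (\<forall>\<phi>\<in>T. value_at M \<phi> [] = 0)"

section \<open>Metric linear orders\<close>

definition order_convex :: "'m set \<Rightarrow> 'm rel \<Rightarrow> 'm set \<Rightarrow> bool" where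
  "order_convex X R C \<longleftrightarrow>
     C \<subseteq> X \<and> (\<forall>x\<in>C. \<forall>y\<in>C. \<forall>z\<in>X. (x, z) \<in> R \<and> (z, y) \<in> R \<longrightarrow> z \<in> C)"

definition metric_linear_order :: "'m metric \<Rightarrow> 'm rel \<Rightarrow> bool" where
  "metric_linear_order D R \<longleftrightarrow>
     linear_order_on (mspace D) R \<and>
     (\<forall>x\<in>mspace D. \<forall>\<epsilon>>0. order_convex (mspace D) R (mball_of D x \<epsilon>))"

text \<open>\<open>MLO_order r M R\<close>: with the order \<open>R\<close>, the reduct of \<open>M\<close> to the language \<open>{r}\<close> is a metric
  linear order with \<open>r(x,y) = inf {d(x,z) | z \<le> y}\<close>.  Completeness and the bound on the diameter
  are part of being a structure.  At most one \<open>R\<close> satisfies this, since \<open>x \<le> y\<close> iff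
  \<open>r(x,y) = 0\<close>.\<close>

definition MLO_order :: "'p \<Rightarrow> ('f, 'p, 'm) cl_struct \<Rightarrow> 'm rel \<Rightarrow> bool" where
  "MLO_order r M R \<longleftrightarrow>
     metric_linear_order (met M) R \<and>
     (\<forall>x\<in>univ M. \<forall>y\<in>univ M.
        pint M r [x, y] = (INF z\<in>{z \<in> univ M. (z, y) \<in> R}. mdist (met M) x z))"

text \<open>\<open>T\<close> expands \<open>MLO\<close> if its language contains \<open>r\<close> and the \<open>{r}\<close>-reduct of each of its models
  is a model of \<open>MLO\<close>.  Since HOL cannot quantify over types inside a formula, here and below
  the models range over all structures whose universe is a subset of a type \<open>'m\<close>, which is a
  parameter.\<close>

definition expands_MLO ::
  "'m itself \<Rightarrow> ('f, 'p) cl_lang \<Rightarrow> 'p \<Rightarrow> ('f, 'p) cl_fm set \<Rightarrow> bool" where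
  "expands_MLO (_ :: 'm itself) L r T \<longleftrightarrow>
     r \<in> Preds L \<and> parity L r = 2 \<and>
     (\<forall>M :: ('f, 'p, 'm) cl_struct. is_model L T M \<longrightarrow> (\<exists>R. MLO_order r M R))"

section \<open>Weak o-minimality\<close>

definition definable_pred1 ::
  "('f, 'p) cl_lang \<Rightarrow> ('f, 'p, 'm) cl_struct \<Rightarrow> ('m \<Rightarrow> real) \<Rightarrow> bool" where
  "definable_pred1 L M P \<longleftrightarrow>
     (\<exists>(\<phi> :: nat \<Rightarrow> ('f, 'p) cl_fm) (bs :: nat \<Rightarrow> 'm list).
        (\<forall>n. set (bs n) \<subseteq> univ M \<and> fm_in L (Suc (length (bs n))) (\<phi> n)) \<and>
        uniform_limit (univ M) (\<lambda>n x. value_at M (\<phi> n) (x # bs n)) P sequentially)"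

definition convex_span :: "'m set \<Rightarrow> 'm rel \<Rightarrow> ('m \<Rightarrow> real) set" where
  "convex_span X R =
     {g. \<exists>(k :: nat) (c :: nat \<Rightarrow> real) (C :: nat \<Rightarrow> 'm set).
           (\<forall>i<k. order_convex X R (C i)) \<and> g = (\<lambda>x. \<Sum>i<k. c i * indicat_real (C i) x)}"

definition weakly_o_minimal ::
  "('f, 'p) cl_lang \<Rightarrow> 'm rel \<Rightarrow> ('f, 'p, 'm) cl_struct \<Rightarrow> bool" where
  "weakly_o_minimal L R M \<longleftrightarrow>
     (\<forall>P. definable_pred1 L M P \<longrightarrow>
        (\<exists>g :: nat \<Rightarrow> 'm \<Rightarrow> real. (\<forall>n. g n \<in> convex_span (univ M) R) \<and>
           uniform_limit (univ M) g P sequentially))"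

section \<open>Indiscernible sequences and distality\<close>

definition indiscernible ::
  "('f, 'p) cl_lang \<Rightarrow> ('f, 'p, 'm) cl_struct \<Rightarrow> 'm set \<Rightarrow> ('i::linorder) set \<Rightarrow> ('i \<Rightarrow> 'm list) \<Rightarrow> bool"
  where
  "indiscernible L M B J a \<longleftrightarrow>
     (\<forall>\<phi> bs us vs.
        set bs \<subseteq> B \<and> set us \<subseteq> J \<and> set vs \<subseteq> J \<and> length us = length vs \<and>
        sorted_wrt (<) us \<and> sorted_wrt (<) vs \<and>
        fm_in L (length (concat (map a us) @ bs)) \<phi> \<longrightarrow>
        value_at M \<phi> (concat (map a us) @ bs) = value_at M \<phi> (concat (map a vs) @ bs))"

text \<open>The sequence \<open>I\<^sub>1 + a + I\<^sub>2\<close> of \<open>n\<close>-tuples is indexed by \<open>I1 \<union> {c} \<union> I2\<close>, with \<open>I1 < c < I2\<close>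
  in a linear order \<open>'i\<close>; the member \<open>a\<close> is the one with index \<open>c\<close>.  Sequences range over
  all models of \<open>T\<close> instead of a monster model for each completion of \<open>T\<close>.\<close>

definition distal ::
  "'m itself \<Rightarrow> ('i::linorder) itself \<Rightarrow> ('f, 'p) cl_lang \<Rightarrow> ('f, 'p) cl_fm set \<Rightarrow> bool" where
  "distal (_ :: 'm itself) (_ :: 'i itself) L T \<longleftrightarrow>
     (\<forall>(M :: ('f, 'p, 'm) cl_struct) (I1 :: 'i set) (c :: 'i) (I2 :: 'i set) (n :: nat)
        (a :: 'i \<Rightarrow> 'm list) (B :: 'm set).
        is_model L T M \<and>
        infinite I1 \<and> infinite I2 \<and> (\<forall>i\<in>I1. i < c) \<and> (\<forall>i\<in>I2. c < i) \<and>
        (\<forall>i\<in>I1. \<exists>j\<in>I1. i < j) \<and> (\<forall>i\<in>I2. \<exists>j\<in>I2. j < i) \<and>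
        (\<forall>i \<in> I1 \<union> {c} \<union> I2. a i \<in> tuples M n) \<and> B \<subseteq> univ M \<and>
        indiscernible L M {} (I1 \<union> {c} \<union> I2) a \<and>
        indiscernible L M B (I1 \<union> I2) a
        \<longrightarrow> indiscernible L M B (I1 \<union> {c} \<union> I2) a)"

end

theory Submission
  imports Defs
begin

text \<open>Adding parameters one at a time, it suffices to treat one new parameter \<open>b\<close>.  Replace the
  member at the cut \<open>c\<close> by members at \<open>i < c < j\<close>, keep all other arguments of a formula \<open>\<phi>\<close> fixed,
  and let \<open>f\<^sub>i, f\<^sub>c, f\<^sub>j\<close> be the resulting functions of the variable for which \<open>b\<close> is substituted; suppose
  that \<open>f\<^sub>i(b) = f\<^sub>j(b) < f\<^sub>c(b)\<close>.  For each \<open>m\<close> the elements that lie above an alternation of length \<open>m\<close>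
  between low and high values of \<open>f\<^sub>q\<close> form a final segment, and by indiscernibility these segments
  are monotone in \<open>q\<close>.  Induction on \<open>m\<close> shows that \<open>b\<close> lies in all of them: if \<open>m\<close> is even, \<open>b\<close>
  prolongs an alternation of \<open>f\<^sub>i\<close> and of \<open>f\<^sub>j\<close>, hence lies in the next segment of \<open>f\<^sub>c\<close>, which is
  between the other two; if \<open>m\<close> is odd, \<open>b\<close> prolongs an alternation of \<open>f\<^sub>c\<close>, hence lies in the next
  segment of \<open>f\<^sub>i\<close> or \<open>f\<^sub>j\<close>, and so in both as \<open>i\<close> and \<open>j\<close> have the same type over \<open>b\<close>.  But by weak
  o-minimality the length of alternations of \<open>f\<^sub>i\<close> is bounded.\<close>

section \<open>Renaming of variables\<close>

lemma teval_cong: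
  "(\<And>v. v \<in> tvars t \<Longrightarrow> e v = e' v) \<Longrightarrow> teval M e t = teval M e' t"
proof (induction t)
  case (Fn f ts)
  have "map (teval M e) ts = map (teval M e') ts"
    using Fn by auto
  then show ?case by (simp only: teval.simps)
qed simp

lemma feval_cong:
  "(\<And>v. v \<in> fvars \<phi> \<Longrightarrow> e v = e' v) \<Longrightarrow> feval M e \<phi> = feval M e' \<phi>"
proof (induction \<phi> arbitrary: e e')
  case (Pred p ts)
  have "map (teval M e) ts = map (teval M e') ts"
    using Pred by (auto intro: teval_cong)
  then show ?case by (simp only: feval.simps)
next
  case (Dist s t)
  then show ?case by (auto intro!: arg_cong2[where f = "mdist (met M)"] teval_cong)
next
  case (Conn u \<phi>s)
  have "map (feval M e) \<phi>s = map (feval M e') \<phi>s"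
    by (intro map_cong refl Conn.IH) (use Conn.prems in auto)
  then show ?case by (simp only: feval.simps)
next
  case (SupQ x \<phi>)
  have "feval M (e(x := m)) \<phi> = feval M (e'(x := m)) \<phi>" for m
    by (rule SupQ.IH) (use SupQ.prems in auto)
  then show ?case by simp
next
  case (InfQ x \<phi>)
  have "feval M (e(x := m)) \<phi> = feval M (e'(x := m)) \<phi>" for m
    by (rule InfQ.IH) (use InfQ.prems in auto)
  then show ?case by simp
qed

lemma finite_tvars: "finite (tvars t)"
  by (induction t) auto

lemma finite_fvars: "finite (fvars \<phi>)"
  by (induction \<phi>) (auto simp: finite_tvars)

fun rename_term :: "(nat \<Rightarrow> nat) \<Rightarrow> 'f cl_term \<Rightarrow> 'f cl_term" where
  "rename_term \<sigma> (Var x) = Var (\<sigma> x)"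
| "rename_term \<sigma> (Fn f ts) = Fn f (map (rename_term \<sigma>) ts)"

lemma teval_rename_term: "teval M e (rename_term \<sigma> t) = teval M (\<lambda>v. e (\<sigma> v)) t"
  by (induction t) (auto simp: comp_def cong: map_cong)

lemma wf_rename_term: "wf_term L t \<Longrightarrow> wf_term L (rename_term \<sigma> t)"
  by (induction t) auto

lemma tvars_rename_term: "tvars (rename_term \<sigma> t) = \<sigma> ` tvars t"
  by (induction t) auto

definition fresh_for :: "nat set \<Rightarrow> nat" where
  "fresh_for V = Suc (Max (insert 0 V))"

lemma fresh_for_notin: "finite V \<Longrightarrow> fresh_for V \<notin> V"
  unfolding fresh_for_def by (metis Max_ge Suc_n_not_le_n finite_insert insertI2)

text \<open>\<open>\<sigma>\<close> may identify variables, as several of them will be merged into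
  one. Capture is avoided by giving each quantifier a variable outside the image of the free
  variables of its body.\<close>

fun rename :: "(nat \<Rightarrow> nat) \<Rightarrow> ('f, 'p) cl_fm \<Rightarrow> ('f, 'p) cl_fm" where
  "rename \<sigma> (Pred p ts) = Pred p (map (rename_term \<sigma>) ts)"
| "rename \<sigma> (Dist s t) = Dist (rename_term \<sigma> s) (rename_term \<sigma> t)"
| "rename \<sigma> (Conn u \<phi>s) = Conn u (map (rename \<sigma>) \<phi>s)"
| "rename \<sigma> (SupQ x \<phi>) =
     SupQ (fresh_for (\<sigma> ` fvars \<phi>)) (rename (\<sigma>(x := fresh_for (\<sigma> ` fvars \<phi>))) \<phi>)"
| "rename \<sigma> (InfQ x \<phi>) =
     InfQ (fresh_for (\<sigma> ` fvars \<phi>)) (rename (\<sigma>(x := fresh_for (\<sigma> ` fvars \<phi>))) \<phi>)"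

lemma wf_rename: "wf_fm L \<phi> \<Longrightarrow> wf_fm L (rename \<sigma> \<phi>)"
  by (induction \<phi> arbitrary: \<sigma>) (auto simp: wf_rename_term)

lemma fvars_rename: "fvars (rename \<sigma> \<phi>) \<subseteq> \<sigma> ` fvars \<phi>"
proof (induction \<phi> arbitrary: \<sigma>)
  case (SupQ x \<phi>)
  define z where "z = fresh_for (\<sigma> ` fvars \<phi>)"
  have "(\<sigma>(x := z)) ` fvars \<phi> \<subseteq> insert z (\<sigma> ` (fvars \<phi> - {x}))"
    by auto
  then have "fvars (rename (\<sigma>(x := z)) \<phi>) - {z} \<subseteq> \<sigma> ` (fvars \<phi> - {x})"
    using SupQ[of "\<sigma>(x := z)"] by blast
  then show ?case by (simp add: z_def)
next
  case (InfQ x \<phi>)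
  define z where "z = fresh_for (\<sigma> ` fvars \<phi>)"
  have "(\<sigma>(x := z)) ` fvars \<phi> \<subseteq> insert z (\<sigma> ` (fvars \<phi> - {x}))"
    by auto
  then have "fvars (rename (\<sigma>(x := z)) \<phi>) - {z} \<subseteq> \<sigma> ` (fvars \<phi> - {x})"
    using InfQ[of "\<sigma>(x := z)"] by blast
  then show ?case by (simp add: z_def)
qed (fastforce simp: tvars_rename_term)+

text \<open>The substitution lemma: as the new bound variable is fresh, updating the outer
  environment agrees with updating the composed one on the free variables of the body.\<close>

lemma feval_rename: "feval M e (rename \<sigma> \<phi>) = feval M (\<lambda>v. e (\<sigma> v)) \<phi>"
proof (induction \<phi> arbitrary: \<sigma> e)
  case (Conn u \<phi>s)
  then have "map (feval M e \<circ> rename \<sigma>) \<phi>s = map (feval M (\<lambda>v. e (\<sigma> v))) \<phi>s"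
    by auto
  then show ?case by (simp only: rename.simps feval.simps map_map)
next
  case (SupQ x \<phi>)
  define z where "z = fresh_for (\<sigma> ` fvars \<phi>)"
  have "z \<notin> \<sigma> ` fvars \<phi>"
    unfolding z_def by (simp add: fresh_for_notin finite_fvars)
  then have "feval M (e(z := m)) (rename (\<sigma>(x := z)) \<phi>) = feval M ((\<lambda>v. e (\<sigma> v))(x := m)) \<phi>" for m
    unfolding SupQ by (intro feval_cong) auto
  then show ?case by (simp add: z_def)
next
  case (InfQ x \<phi>)
  define z where "z = fresh_for (\<sigma> ` fvars \<phi>)"
  have "z \<notin> \<sigma> ` fvars \<phi>"
    unfolding z_def by (simp add: fresh_for_notin finite_fvars)
  then have "feval M (e(z := m)) (rename (\<sigma>(x := z)) \<phi>) = feval M ((\<lambda>v. e (\<sigma> v))(x := m)) \<phi>" for m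
    unfolding InfQ by (intro feval_cong) auto
  then show ?case by (simp add: z_def)
qed (auto simp: teval_rename_term comp_def)

section \<open>Uniform continuity of formulas\<close>

text \<open>Tychonoff's theorem; it turns the continuity of connectives into uniform
  continuity.\<close>

lemma compact_unit_cube: "compact {x :: nat \<Rightarrow> real. range x \<subseteq> {0..1}}"
proof -
  have "compactin (product_topology (\<lambda>_. euclidean) UNIV) (PiE UNIV (\<lambda>_::nat. {0..1::real}))"
    by (simp add: compactin_PiE)
  moreover have "PiE UNIV (\<lambda>_::nat. {0..1::real}) = {x. range x \<subseteq> {0..1}}"
    by (fastforce simp: PiE_def)
  ultimately show ?thesis
    by (simp add: euclidean_product_topology)
qed

text \<open>The product metric weights coordinates by a geometric series of sum 2; this links it to
  the coordinatewise bounds used for lists of values.\<close>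

lemma dist_fun_le:
  fixes x y :: "nat \<Rightarrow> real"
  assumes "\<And>n. \<bar>x n - y n\<bar> \<le> \<delta>"
  shows "dist x y \<le> 2 * \<delta>"
proof -
  have s: "summable (\<lambda>n. (1/2)^n :: real)"
    by (simp add: summable_geometric_iff)
  have le: "(1/2)^n * min (dist (x (from_nat n)) (y (from_nat n))) 1 \<le> (1/2)^n * \<delta>" for n
    using assms[of "from_nat n"] by (intro mult_left_mono) (auto simp: dist_real_def min_le_iff_disj)
  have "dist x y \<le> (\<Sum>n. (1/2)^n * \<delta>)"
    unfolding dist_fun_def
  proof (rule suminf_le[OF le])
    show "summable (\<lambda>n. (1/2)^n * min (dist (x (from_nat n)) (y (from_nat n))) 1)"
      by (rule summable_comparison_test'[OF s]) auto
    show "summable (\<lambda>n. (1/2)^n * \<delta>)"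
      by (rule summable_mult2[OF s])
  qed
  also have "\<dots> = (\<Sum>n. (1/2)^n) * \<delta>"
    by (rule suminf_mult2[OF s, symmetric])
  also have "\<dots> = 2 * \<delta>"
    using suminf_geometric[of "1/2::real"] by simp
  finally show ?thesis .
qed

lemma connective_uniformly_continuous:
  assumes "connective n u" and "\<epsilon> > 0"
  shows "\<exists>\<delta>>0. \<forall>xs ys. length xs = n \<and> length ys = n \<and> set xs \<subseteq> {0..1} \<and> set ys \<subseteq> {0..1} \<and>
           (\<forall>i<n. \<bar>xs ! i - ys ! i\<bar> \<le> \<delta>) \<longrightarrow> \<bar>u xs - u ys\<bar> < \<epsilon>"
proof -
  let ?Q = "{x :: nat \<Rightarrow> real. range x \<subseteq> {0..1}}"
  have "uniformly_continuous_on ?Q (\<lambda>x. u (map x [0..<n]))"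
    using assms(1) unfolding connective_def
    by (intro compact_uniformly_continuous compact_unit_cube) auto
  then obtain d where d: "d > 0"
      "\<And>x y. x \<in> ?Q \<Longrightarrow> y \<in> ?Q \<Longrightarrow> dist y x < d \<Longrightarrow>
         dist (u (map y [0..<n])) (u (map x [0..<n])) < \<epsilon>"
    using assms(2) unfolding uniformly_continuous_on_def by metis
  \<comment> \<open>Padding with 0 embeds the lists into the cube without changing the value of the
    connective.\<close>
  define ext :: "real list \<Rightarrow> nat \<Rightarrow> real" where "ext zs = (\<lambda>i. if i < n then zs ! i else 0)" for zs
  have map_ext: "map (ext zs) [0..<n] = zs" if "length zs = n" for zs
    using that by (intro nth_equalityI) (auto simp: ext_def)
  have ext_in: "ext zs \<in> ?Q" if "length zs = n" "set zs \<subseteq> {0..1}" for zs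
    using that by (fastforce simp: ext_def subset_iff)
  show ?thesis
  \<comment> \<open>Coordinatewise distance \<open>d/4\<close> gives at most \<open>d/2\<close> in
    the cube, strictly below \<open>d\<close>.\<close>
  proof (intro exI[of _ "d/4"] conjI allI impI)
    fix xs ys :: "real list"
    assume *: "length xs = n \<and> length ys = n \<and> set xs \<subseteq> {0..1} \<and> set ys \<subseteq> {0..1} \<and>
           (\<forall>i<n. \<bar>xs ! i - ys ! i\<bar> \<le> d/4)"
    have "dist (ext xs) (ext ys) \<le> 2 * (d/4)"
      using * d(1) by (intro dist_fun_le) (auto simp: ext_def)
    then have "dist (ext xs) (ext ys) < d"
      using d(1) by simp
    then have "dist (u (map (ext xs) [0..<n])) (u (map (ext ys) [0..<n])) < \<epsilon>"
      using * by (intro d(2) ext_in) auto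
    then show "\<bar>u xs - u ys\<bar> < \<epsilon>"
      using * by (simp add: map_ext dist_real_def)
  qed (use d in simp)
qed

lemma abs_SUP_diff_le:
  fixes f g :: "'a \<Rightarrow> real"
  assumes "S \<noteq> {}" "\<And>x. x \<in> S \<Longrightarrow> f x \<in> {0..1}" "\<And>x. x \<in> S \<Longrightarrow> g x \<in> {0..1}"
    and "\<And>x. x \<in> S \<Longrightarrow> \<bar>f x - g x\<bar> \<le> \<epsilon>"
  shows "\<bar>(SUP x\<in>S. f x) - (SUP x\<in>S. g x)\<bar> \<le> \<epsilon>"
proof -
  have bdd: "bdd_above (f ` S)" "bdd_above (g ` S)"
    using assms by (auto intro!: bdd_aboveI[of _ 1])
  have "(SUP x\<in>S. f x) \<le> (SUP x\<in>S. g x) + \<epsilon>"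
    using assms(1)
  proof (rule cSUP_least)
    fix x assume "x \<in> S"
    with cSUP_upper[OF this bdd(2)] assms(4)[OF this] show "f x \<le> (SUP x\<in>S. g x) + \<epsilon>"
      by linarith
  qed
  moreover have "(SUP x\<in>S. g x) \<le> (SUP x\<in>S. f x) + \<epsilon>"
    using assms(1)
  proof (rule cSUP_least)
    fix x assume "x \<in> S"
    with cSUP_upper[OF this bdd(1)] assms(4)[OF this] show "g x \<le> (SUP x\<in>S. f x) + \<epsilon>"
      by linarith
  qed
  ultimately show ?thesis by linarith
qed

lemma abs_INF_diff_le:
  fixes f g :: "'a \<Rightarrow> real"
  assumes "S \<noteq> {}" "\<And>x. x \<in> S \<Longrightarrow> f x \<in> {0..1}" "\<And>x. x \<in> S \<Longrightarrow> g x \<in> {0..1}"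
    and "\<And>x. x \<in> S \<Longrightarrow> \<bar>f x - g x\<bar> \<le> \<epsilon>"
  shows "\<bar>(INF x\<in>S. f x) - (INF x\<in>S. g x)\<bar> \<le> \<epsilon>"
proof -
  have bdd: "bdd_below (f ` S)" "bdd_below (g ` S)"
    using assms by (auto intro!: bdd_belowI[of _ 0])
  have "(INF x\<in>S. f x) - \<epsilon> \<le> (INF x\<in>S. g x)"
    using assms(1)
  proof (rule cINF_greatest)
    fix x assume "x \<in> S"
    with cINF_lower[OF bdd(1) this] assms(4)[OF this] show "(INF x\<in>S. f x) - \<epsilon> \<le> g x"
      by linarith
  qed
  moreover have "(INF x\<in>S. g x) - \<epsilon> \<le> (INF x\<in>S. f x)"
    using assms(1)
  proof (rule cINF_greatest)
    fix x assume "x \<in> S"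
    with cINF_lower[OF bdd(2) this] assms(4)[OF this] show "(INF x\<in>S. g x) - \<epsilon> \<le> f x"
      by linarith
  qed
  ultimately show ?thesis by linarith
qed

section \<open>Bounds and uniform continuity of terms and formulas in a structure\<close>

locale cl_structure =
  fixes L :: "('f, 'p) cl_lang" and M :: "('f, 'p, 'm) cl_struct"
  assumes lang: "is_lang L" and struct: "is_struct L M"
begin

abbreviation env :: "(nat \<Rightarrow> 'm) \<Rightarrow> bool" where
  "env e \<equiv> range e \<subseteq> univ M"

lemma univ_nonempty: "univ M \<noteq> {}"
  using struct unfolding is_struct_def by (rule conjunct1)

lemma env_upd: "env e \<Longrightarrow> m \<in> univ M \<Longrightarrow> env (e(x := m))"
  by auto

lemma teval_in_univ: "wf_term L t \<Longrightarrow> env e \<Longrightarrow> teval M e t \<in> univ M"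
proof (induction t)
  case (Fn f ts)
  then have "map (teval M e) ts \<in> tuples M (farity L f)"
    by (auto simp: tuples_def)
  then show ?case
    using struct Fn unfolding is_struct_def by auto
qed auto

lemma map_teval_in_tuples:
  "\<forall>t\<in>set ts. wf_term L t \<Longrightarrow> env e \<Longrightarrow> map (teval M e) ts \<in> tuples M (length ts)"
  by (auto simp: tuples_def intro: teval_in_univ)

lemma feval_in_unit: "wf_fm L \<phi> \<Longrightarrow> env e \<Longrightarrow> feval M e \<phi> \<in> {0..1}"
proof (induction \<phi> arbitrary: e)
  case (Pred p ts)
  then have "pint M p (map (teval M e) ts) \<in> {0..1}"
    using struct map_teval_in_tuples[of ts e] unfolding is_struct_def by simp
  then show ?case by simp
next
  case (Dist s t)
  then show ?case
    using struct teval_in_univ[of s e] teval_in_univ[of t e] unfolding is_struct_def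
    by (simp add: Metric_space.nonneg[OF Metric_space_mspace_mdist])
next
  case (Conn u \<phi>s)
  have "length (map (feval M e) \<phi>s) = length \<phi>s \<and> set (map (feval M e) \<phi>s) \<subseteq> {0..1}"
    using Conn by (auto simp del: atLeastAtMost_iff)
  then have "u (map (feval M e) \<phi>s) \<in> {0..1}"
    using Conn.prems(1) unfolding wf_fm.simps connective_def by blast
  then show ?case by simp
next
  case (SupQ x \<phi>)
  have v: "feval M (e(x := m)) \<phi> \<in> {0..1}" if "m \<in> univ M" for m
    using SupQ.prems that by (intro SupQ.IH) auto
  obtain m where m: "m \<in> univ M" using univ_nonempty by auto
  have "feval M (e(x := m)) \<phi> \<le> (SUP m\<in>univ M. feval M (e(x := m)) \<phi>)"
    using v by (intro cSUP_upper m bdd_aboveI[of _ 1]) auto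
  moreover have "(SUP m\<in>univ M. feval M (e(x := m)) \<phi>) \<le> 1"
    using v by (intro cSUP_least univ_nonempty) auto
  ultimately show ?case using v[OF m] by auto
next
  case (InfQ x \<phi>)
  have v: "feval M (e(x := m)) \<phi> \<in> {0..1}" if "m \<in> univ M" for m
    using InfQ.prems that by (intro InfQ.IH) auto
  obtain m where m: "m \<in> univ M" using univ_nonempty by auto
  have "(INF m\<in>univ M. feval M (e(x := m)) \<phi>) \<le> feval M (e(x := m)) \<phi>"
    using v by (intro cINF_lower m bdd_belowI[of _ 0]) auto
  moreover have "0 \<le> (INF m\<in>univ M. feval M (e(x := m)) \<phi>)"
    using v by (intro cINF_greatest univ_nonempty) auto
  ultimately show ?case using v[OF m] by auto
qed

lemma mdist_self: "x \<in> univ M \<Longrightarrow> mdist (met M) x x = 0"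
  using Metric_space.zero[OF Metric_space_mspace_mdist, of x "met M" x] by simp

lemma mdist_nonneg: "0 \<le> mdist (met M) x y"
  by (rule Metric_space.nonneg[OF Metric_space_mspace_mdist])

definition env_close :: "real \<Rightarrow> (nat \<Rightarrow> 'm) \<Rightarrow> (nat \<Rightarrow> 'm) \<Rightarrow> bool" where
  "env_close \<delta> e e' \<longleftrightarrow> env e \<and> env e' \<and> (\<forall>v. mdist (met M) (e v) (e' v) < \<delta>)"

lemma env_close_upd:
  assumes "env_close \<delta> e e'" "m \<in> univ M"
  shows "env_close \<delta> (e(x := m)) (e'(x := m))"
proof -
  have "\<delta> > 0"
    using assms(1) le_less_trans[OF mdist_nonneg, of "e x" "e' x" \<delta>] unfolding env_close_def by simp
  then show ?thesis
    using assms unfolding env_close_def by (intro conjI env_upd) (auto simp: mdist_self)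
qed

lemma close_tuples_teval:
  assumes "\<And>t. t \<in> set ts \<Longrightarrow> mdist (met M) (teval M e t) (teval M e' t) < \<delta>"
  shows "close_tuples M \<delta> (map (teval M e) ts) (map (teval M e') ts)"
  using assms unfolding close_tuples_def by (induction ts) auto

lemma fint_modulus:
  "f \<in> Funs L \<Longrightarrow> \<epsilon> > 0 \<Longrightarrow> xs \<in> tuples M (farity L f) \<Longrightarrow> ys \<in> tuples M (farity L f) \<Longrightarrow>
   close_tuples M (fmodulus L f \<epsilon>) xs ys \<Longrightarrow> mdist (met M) (fint M f xs) (fint M f ys) \<le> \<epsilon>"
  using struct[unfolded is_struct_def, THEN conjunct2, THEN conjunct2, THEN conjunct2, THEN conjunct1]
  by simp

text \<open>Saying "for all small \<open>\<delta>\<close>" as an eventuality at 0 lets the finitely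
  many bounds for the arguments be combined without taking minima.\<close>

lemma teval_uniformly_continuous:
  assumes "wf_term L t" "\<epsilon> > 0"
  shows "\<forall>\<^sub>F \<delta> in at_right (0::real).
           \<forall>e e'. env_close \<delta> e e' \<longrightarrow> mdist (met M) (teval M e t) (teval M e' t) < \<epsilon>"
  using assms
proof (induction t arbitrary: \<epsilon>)
  case (Var x)
  have "\<forall>\<^sub>F \<delta> in at_right (0::real). \<delta> < \<epsilon>"
    using Var by (auto simp: eventually_at_right_field)
  then show ?case
    by eventually_elim (auto simp: env_close_def intro: less_trans)
next
  case (Fn f ts)
  \<comment> \<open>The modulus yields a weak inequality only, so \<open>\<epsilon>/2\<close> is
    used to obtain a strict one.\<close>
  have "fmodulus L f (\<epsilon>/2) > 0"
    using lang Fn.prems unfolding is_lang_def by auto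
  then have "\<forall>\<^sub>F \<delta> in at_right (0::real). \<forall>t\<in>set ts. \<forall>e e'. env_close \<delta> e e' \<longrightarrow>
      mdist (met M) (teval M e t) (teval M e' t) < fmodulus L f (\<epsilon>/2)"
    using Fn by (intro eventually_ball_finite) auto
  then show ?case
  proof eventually_elim
    case (elim \<delta>)
    show ?case
    proof (intro allI impI)
      fix e e' assume c: "env_close \<delta> e e'"
      have "mdist (met M) (fint M f (map (teval M e) ts)) (fint M f (map (teval M e') ts)) \<le> \<epsilon>/2"
        using Fn.prems elim c map_teval_in_tuples[of ts e] map_teval_in_tuples[of ts e']
        by (intro fint_modulus close_tuples_teval) (auto simp: env_close_def)
      then show "mdist (met M) (teval M e (Fn f ts)) (teval M e' (Fn f ts)) < \<epsilon>"
        using Fn.prems by simp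
    qed
  qed
qed

text \<open>For quantifiers the same \<open>\<delta>\<close> serves: giving a variable the same
  value in both environments keeps them close, and a uniform bound passes to suprema and
  infima.\<close>

lemma feval_uniformly_continuous:
  assumes "wf_fm L \<phi>" "\<epsilon> > 0"
  shows "\<forall>\<^sub>F \<delta> in at_right (0::real).
           \<forall>e e'. env_close \<delta> e e' \<longrightarrow> \<bar>feval M e \<phi> - feval M e' \<phi>\<bar> \<le> \<epsilon>"
  using assms
proof (induction \<phi> arbitrary: \<epsilon>)
  case (Pred p ts)
  have "pmodulus L p \<epsilon> > 0"
    using lang Pred.prems unfolding is_lang_def by auto
  then have "\<forall>\<^sub>F \<delta> in at_right (0::real). \<forall>t\<in>set ts. \<forall>e e'. env_close \<delta> e e' \<longrightarrow>
      mdist (met M) (teval M e t) (teval M e' t) < pmodulus L p \<epsilon>"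
    using Pred by (intro eventually_ball_finite) (auto intro: teval_uniformly_continuous)
  then show ?case
  proof eventually_elim
    case (elim \<delta>)
    show ?case
    proof (intro allI impI)
      fix e e' assume c: "env_close \<delta> e e'"
      show "\<bar>feval M e (Pred p ts) - feval M e' (Pred p ts)\<bar> \<le> \<epsilon>"
        using struct Pred.prems close_tuples_teval[of ts e e' "pmodulus L p \<epsilon>"] elim c
          map_teval_in_tuples[of ts e] map_teval_in_tuples[of ts e']
        unfolding is_struct_def env_close_def by simp
    qed
  qed
next
  case (Dist s t)
  have "\<forall>\<^sub>F \<delta> in at_right (0::real). \<forall>e e'. env_close \<delta> e e' \<longrightarrow>
          mdist (met M) (teval M e s) (teval M e' s) < \<epsilon>/2"
    "\<forall>\<^sub>F \<delta> in at_right (0::real). \<forall>e e'. env_close \<delta> e e' \<longrightarrow>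
          mdist (met M) (teval M e t) (teval M e' t) < \<epsilon>/2"
    using Dist by (intro teval_uniformly_continuous; simp)+
  then show ?case
  proof eventually_elim
    case (elim \<delta>)
    show ?case
    proof (intro allI impI)
      fix e e' assume c: "env_close \<delta> e e'"
      have "mdist (met M) (teval M e s) (teval M e' s) < \<epsilon>/2"
        "mdist (met M) (teval M e t) (teval M e' t) < \<epsilon>/2"
        using elim c by auto
      moreover have "teval M e s \<in> univ M" "teval M e' s \<in> univ M"
        "teval M e t \<in> univ M" "teval M e' t \<in> univ M"
        using c Dist.prems by (auto simp: env_close_def intro!: teval_in_univ)
      ultimately show "\<bar>feval M e (Dist s t) - feval M e' (Dist s t)\<bar> \<le> \<epsilon>"
        using Metric_space.triangle[OF Metric_space_mspace_mdist[of "met M"]]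
          Metric_space.commute[OF Metric_space_mspace_mdist[of "met M"]]
        by simp (smt (verit) field_sum_of_halves)
    qed
  qed
next
  case (Conn u \<phi>s)
  obtain d where d: "d > 0" "\<And>xs ys. length xs = length \<phi>s \<and> length ys = length \<phi>s \<and>
      set xs \<subseteq> {0..1} \<and> set ys \<subseteq> {0..1} \<and> (\<forall>i<length \<phi>s. \<bar>xs ! i - ys ! i\<bar> \<le> d) \<Longrightarrow>
      \<bar>u xs - u ys\<bar> < \<epsilon>"
    using connective_uniformly_continuous[of "length \<phi>s" u \<epsilon>] Conn.prems by auto
  have "\<forall>\<^sub>F \<delta> in at_right (0::real). \<forall>\<phi>\<in>set \<phi>s. \<forall>e e'. env_close \<delta> e e' \<longrightarrow>
      \<bar>feval M e \<phi> - feval M e' \<phi>\<bar> \<le> d"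
    using Conn d(1) by (intro eventually_ball_finite) auto
  then show ?case
  proof eventually_elim
    case (elim \<delta>)
    show ?case
    proof (intro allI impI)
      fix e e' assume c: "env_close \<delta> e e'"
      have v: "set (map (feval M e) \<phi>s) \<subseteq> {0..1}" if "env e" for e
        using Conn.prems that by (auto simp del: atLeastAtMost_iff intro!: feval_in_unit)
      have "\<bar>u (map (feval M e) \<phi>s) - u (map (feval M e') \<phi>s)\<bar> < \<epsilon>"
        using c elim v[of e] v[of e'] by (intro d(2)) (auto simp: env_close_def)
      then show "\<bar>feval M e (Conn u \<phi>s) - feval M e' (Conn u \<phi>s)\<bar> \<le> \<epsilon>"
        by simp
    qed
  qed
next
  case (SupQ x \<phi>)
  have "\<forall>\<^sub>F \<delta> in at_right (0::real). \<forall>e e'. env_close \<delta> e e' \<longrightarrow> \<bar>feval M e \<phi> - feval M e' \<phi>\<bar> \<le> \<epsilon>"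
    using SupQ by auto
  then show ?case
  proof eventually_elim
    case (elim \<delta>)
    show ?case
    proof (intro allI impI)
      fix e e' assume "env_close \<delta> e e'"
      then show "\<bar>feval M e (SupQ x \<phi>) - feval M e' (SupQ x \<phi>)\<bar> \<le> \<epsilon>"
        unfolding feval.simps using elim SupQ.prems
        by (intro abs_SUP_diff_le univ_nonempty feval_in_unit env_upd)
          (auto simp: env_close_upd, auto simp: env_close_def)
    qed
  qed
next
  case (InfQ x \<phi>)
  have "\<forall>\<^sub>F \<delta> in at_right (0::real). \<forall>e e'. env_close \<delta> e e' \<longrightarrow> \<bar>feval M e \<phi> - feval M e' \<phi>\<bar> \<le> \<epsilon>"
    using InfQ by auto
  then show ?case
  proof eventually_elim
    case (elim \<delta>)
    show ?case
    proof (intro allI impI)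
      fix e e' assume "env_close \<delta> e e'"
      then show "\<bar>feval M e (InfQ x \<phi>) - feval M e' (InfQ x \<phi>)\<bar> \<le> \<epsilon>"
        unfolding feval.simps using elim InfQ.prems
        by (intro abs_INF_diff_le univ_nonempty feval_in_unit env_upd)
          (auto simp: env_close_upd, auto simp: env_close_def)
    qed
  qed
qed

end

section \<open>Separation by formulas\<close>

lemma continuous_on_coordinate: "continuous_on S (\<lambda>x :: nat \<Rightarrow> real. x i)"
  by (rule continuous_on_subset[OF continuous_on_product_coordinates subset_UNIV])

lemma connective_complement: "connective (Suc 0) (\<lambda>xs. 1 - xs ! 0)"
  unfolding connective_def
  by (auto simp: length_Suc_conv intro!: continuous_intros continuous_on_coordinate)

context cl_structure
begin

text \<open>Continuous logic cannot express properties of environments exactly.  Instead a property is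
  approximated by a weaker one and a formula that is \<open>0\<close> on the former and \<open>1\<close> off the latter;
  this calculus is closed under all first-order operations, including negation.\<close>

definition separates ::
  "('f, 'p) cl_fm \<Rightarrow> nat set \<Rightarrow> ((nat \<Rightarrow> 'm) \<Rightarrow> bool) \<Rightarrow> ((nat \<Rightarrow> 'm) \<Rightarrow> bool) \<Rightarrow> bool" where
  "separates \<psi> V P Q \<longleftrightarrow> wf_fm L \<psi> \<and> fvars \<psi> \<subseteq> V \<and>
     (\<forall>e. env e \<longrightarrow> (P e \<longrightarrow> feval M e \<psi> = 0) \<and> (\<not> Q e \<longrightarrow> feval M e \<psi> = 1))"

definition sep :: "nat set \<Rightarrow> ((nat \<Rightarrow> 'm) \<Rightarrow> bool) \<Rightarrow> ((nat \<Rightarrow> 'm) \<Rightarrow> bool) \<Rightarrow> bool" where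
  "sep V P Q \<longleftrightarrow> (\<exists>\<psi>. separates \<psi> V P Q)"

lemma sepI:
  assumes "wf_fm L \<psi>" "fvars \<psi> \<subseteq> V"
    and "\<And>e. env e \<Longrightarrow> P e \<Longrightarrow> feval M e \<psi> = 0" "\<And>e. env e \<Longrightarrow> \<not> Q e \<Longrightarrow> feval M e \<psi> = 1"
  shows "sep V P Q"
  unfolding sep_def separates_def by (intro exI[of _ \<psi>] conjI allI impI assms)

lemma separatesD:
  assumes "separates \<psi> V P Q"
  shows "wf_fm L \<psi>" "fvars \<psi> \<subseteq> V"
    "\<And>e. env e \<Longrightarrow> P e \<Longrightarrow> feval M e \<psi> = 0" "\<And>e. env e \<Longrightarrow> \<not> Q e \<Longrightarrow> feval M e \<psi> = 1"
proof -
  note * = assms[unfolded separates_def]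
  show "wf_fm L \<psi>" by (rule *[THEN conjunct1])
  show "fvars \<psi> \<subseteq> V" by (rule *[THEN conjunct2, THEN conjunct1])
  fix e assume "env e"
  note ** = *[THEN conjunct2, THEN conjunct2, THEN spec, THEN mp, OF this]
  show "P e \<Longrightarrow> feval M e \<psi> = 0" by (rule **[THEN conjunct1, THEN mp])
  show "\<not> Q e \<Longrightarrow> feval M e \<psi> = 1" by (rule **[THEN conjunct2, THEN mp])
qed

lemma sep_mono:
  assumes "sep V P Q" "V \<subseteq> W" "\<And>e. env e \<Longrightarrow> P' e \<Longrightarrow> P e" "\<And>e. env e \<Longrightarrow> Q e \<Longrightarrow> Q' e"
  shows "sep W P' Q'"
proof -
  obtain \<psi> where "separates \<psi> V P Q"
    using assms(1) unfolding sep_def ..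
  note \<psi> = separatesD[OF this]
  show ?thesis
    using \<psi>(1)
  proof (rule sepI)
    show "fvars \<psi> \<subseteq> W"
      using \<psi>(2) assms(2) by (rule subset_trans)
    show "feval M e \<psi> = 0" if "env e" "P' e" for e
      using \<psi>(3)[OF that(1) assms(3)[OF that]] .
    show "feval M e \<psi> = 1" if "env e" "\<not> Q' e" for e
      using \<psi>(4)[OF that(1)] assms(4)[OF that(1)] that(2) by satx
  qed
qed

lemma sep_subset: "sep V P Q \<Longrightarrow> V \<subseteq> W \<Longrightarrow> sep W P Q"
  by (rule sep_mono)

text \<open>The way out of the calculus: a separating formula with equal values at \<open>e\<close>
  and \<open>e'\<close> cannot be 0 at the one and 1 at the other.\<close>

lemma sep_transfer:
  assumes "sep V P Q" "env e" "env e'" "P e"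
    and "\<And>\<psi>. wf_fm L \<psi> \<Longrightarrow> fvars \<psi> \<subseteq> V \<Longrightarrow> feval M e \<psi> = feval M e' \<psi>"
  shows "Q e'"
proof (rule ccontr)
  assume "\<not> Q e'"
  obtain \<psi> where "separates \<psi> V P Q"
    using assms(1) unfolding sep_def ..
  note \<psi> = separatesD[OF this]
  have "feval M e \<psi> = 0" "feval M e' \<psi> = 1"
    using \<psi>(3)[OF assms(2,4)] \<psi>(4)[OF assms(3) \<open>\<not> Q e'\<close>] by simp_all
  then show False
    using assms(5)[OF \<psi>(1,2)] by simp
qed

lemma sep_true: "sep V (\<lambda>_. True) (\<lambda>_. True)"
  by (rule sepI[of "Conn (\<lambda>_. 0) []"]) (auto simp: connective_def)

text \<open>Complementing the formula exchanges 0 and 1, so the two properties change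
  places.\<close>

lemma sep_not:
  assumes "sep V P Q"
  shows "sep V (\<lambda>e. \<not> Q e) (\<lambda>e. \<not> P e)"
proof -
  obtain \<psi> where "separates \<psi> V P Q"
    using assms unfolding sep_def ..
  note \<psi> = separatesD[OF this]
  show ?thesis
    using connective_complement \<psi>(1,2) by (intro sepI[of "Conn (\<lambda>xs. 1 - xs ! 0) [\<psi>]"]) (simp_all add: \<psi>(3,4))
qed

lemma sep_conj:
  assumes "sep V P Q" "sep V P' Q'"
  shows "sep V (\<lambda>e. P e \<and> P' e) (\<lambda>e. Q e \<and> Q' e)"
proof -
  obtain \<psi> where "separates \<psi> V P Q"
    using assms(1) unfolding sep_def ..
  note \<psi> = separatesD[OF this]
  obtain \<psi>' where "separates \<psi>' V P' Q'"
    using assms(2) unfolding sep_def ..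
  note \<psi>' = separatesD[OF this]
  have c: "connective (Suc (Suc 0)) (\<lambda>xs. max (xs ! 0) (xs ! 1))"
    unfolding connective_def
    by (auto simp: length_Suc_conv intro!: continuous_intros continuous_on_coordinate)
  show ?thesis
  proof (rule sepI[of "Conn (\<lambda>xs. max (xs ! 0) (xs ! 1)) [\<psi>, \<psi>']"])
    fix e assume e: "env e" "\<not> (Q e \<and> Q' e)"
    have "feval M e \<psi> \<in> {0..1}" "feval M e \<psi>' \<in> {0..1}"
      using \<psi>(1) \<psi>'(1) e(1) by (simp_all only: feval_in_unit)
    then show "feval M e (Conn (\<lambda>xs. max (xs ! 0) (xs ! 1)) [\<psi>, \<psi>']) = 1"
      using \<psi>(4)[of e] \<psi>'(4)[of e] e by auto
  qed (use c \<psi>(1,2) \<psi>'(1,2) in \<open>simp_all add: \<psi>(3) \<psi>'(3)\<close>)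
qed

text \<open>An infimum need not be attained, but where \<open>Q\<close> fails for every
  \<open>m\<close> the formula is constantly 1, so approximate witnesses do not arise.\<close>

lemma sep_ex:
  assumes "sep (insert z V) P Q"
  shows "sep V (\<lambda>e. \<exists>m\<in>univ M. P (e(z := m))) (\<lambda>e. \<exists>m\<in>univ M. Q (e(z := m)))"
proof -
  obtain \<psi> where "separates \<psi> (insert z V) P Q"
    using assms unfolding sep_def ..
  note \<psi> = separatesD[OF this]
  show ?thesis
  proof (rule sepI[of "InfQ z \<psi>"])
    fix e assume e: "env e" "\<exists>m\<in>univ M. P (e(z := m))"
    from e(2) obtain m where m: "m \<in> univ M" and P: "P (e(z := m))" ..
    have "bdd_below ((\<lambda>m. feval M (e(z := m)) \<psi>) ` univ M)"
      using feval_in_unit[OF \<psi>(1) env_upd[OF e(1)]] by (intro bdd_belowI[of _ 0]) auto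
    from cINF_lower[OF this m] have "feval M e (InfQ z \<psi>) \<le> 0"
      using \<psi>(3)[OF env_upd[OF e(1) m] P] by simp
    moreover have "feval M e (InfQ z \<psi>) \<in> {0..1}"
      using \<psi>(1) e(1) by (intro feval_in_unit) simp
    ultimately show "feval M e (InfQ z \<psi>) = 0"
      by simp
  next
    fix e assume e: "env e" "\<not> (\<exists>m\<in>univ M. Q (e(z := m)))"
    then have "feval M (e(z := m)) \<psi> = 1" if "m \<in> univ M" for m
      using \<psi>(4)[OF env_upd[OF e(1) that]] e(2) that by blast
    then show "feval M e (InfQ z \<psi>) = 1"
      using univ_nonempty by simp
  qed (use \<psi>(1,2) in auto)
qed

lemma sep_le:
  assumes "wf_fm L \<psi>" "fvars \<psi> \<subseteq> V" "s < t"
  shows "sep V (\<lambda>e. feval M e \<psi> \<le> s) (\<lambda>e. feval M e \<psi> \<le> t)"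
proof -
  \<comment> \<open>The linear ramp from 0 at \<open>s\<close> to 1 at \<open>t\<close>, truncated
    to the unit interval.\<close>
  let ?u = "\<lambda>xs. max 0 (min 1 ((xs ! 0 - s) / (t - s)))"
  have "connective (Suc 0) ?u"
    unfolding connective_def using assms(3)
    by (auto simp: length_Suc_conv intro!: continuous_intros continuous_on_coordinate)
  moreover have "max 0 (min 1 ((v - s) / (t - s))) = 0" if "v \<le> s" for v
    using that assms(3) divide_nonpos_pos[of "v - s" "t - s"] by simp
  moreover have "max 0 (min 1 ((v - s) / (t - s))) = 1" if "\<not> v \<le> t" for v
    using that assms(3) by (simp add: min_def max_def field_simps)
  ultimately show ?thesis
    using assms(1,2) by (intro sepI[of "Conn ?u [\<psi>]"]) simp_all
qed

text \<open>The complement of \<open>sep_le\<close> for \<open>s\<close> and the midpoint; stopping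
  at the midpoint makes up for the strictness of negated inequalities.\<close>

lemma sep_ge:
  assumes "wf_fm L \<psi>" "fvars \<psi> \<subseteq> V" "s < t"
  shows "sep V (\<lambda>e. feval M e \<psi> \<ge> t) (\<lambda>e. feval M e \<psi> \<ge> s)"
proof -
  have lt: "s < (s + t)/2" "(s + t)/2 < t"
    using assms(3) by simp_all
  have "sep V (\<lambda>e. \<not> feval M e \<psi> \<le> (s + t)/2) (\<lambda>e. \<not> feval M e \<psi> \<le> s)"
    by (rule sep_not[OF sep_le[OF assms(1,2) lt(1)]])
  then show ?thesis
  proof (rule sep_mono[OF _ subset_refl])
    fix e
    show "t \<le> feval M e \<psi> \<Longrightarrow> \<not> feval M e \<psi> \<le> (s + t)/2"
      using lt(2) by linarith
    show "\<not> feval M e \<psi> \<le> s \<Longrightarrow> s \<le> feval M e \<psi>"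
      by linarith
  qed
qed

end

section \<open>Alternations of a function along a metric linear order\<close>

locale mlo_structure = cl_structure L M
  for L :: "('f, 'p) cl_lang" and M :: "('f, 'p, 'm) cl_struct" +
  fixes r :: 'p and R :: "'m rel"
  assumes r_pred: "r \<in> Preds L" "parity L r = 2" and order: "MLO_order r M R"
begin

lemma linear_order: "linear_order_on (univ M) R"
  using order unfolding MLO_order_def metric_linear_order_def by (elim conjE)

lemma le_refl: "x \<in> univ M \<Longrightarrow> (x, x) \<in> R"
  using linear_order by (simp add: order_on_defs refl_on_def)

lemma le_trans: "(x, y) \<in> R \<Longrightarrow> (y, z) \<in> R \<Longrightarrow> (x, z) \<in> R"
  using linear_order unfolding order_on_defs by (elim conjE) (rule transD)

lemma le_linear: "x \<in> univ M \<Longrightarrow> y \<in> univ M \<Longrightarrow> (x, y) \<in> R \<or> (y, x) \<in> R"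
  using linear_order le_refl[of x] unfolding order_on_defs total_on_def by (cases "x = y") simp_all

text \<open>The open ball of radius \<open>\<eta>\<close> around \<open>x\<close> is order-convex
  and contains \<open>x\<close> and \<open>y\<close>.\<close>

lemma dist_between:
  assumes "x \<in> univ M" "y \<in> univ M" "z \<in> univ M" "(y, z) \<in> R" "(z, x) \<in> R"
    and "mdist (met M) x y < \<eta>"
  shows "mdist (met M) x z < \<eta>"
proof -
  have "\<eta> > 0"
    using assms(6) mdist_nonneg
    by (meson le_less_trans)
  then have "order_convex (univ M) R (mball_of (met M) x \<eta>)"
    using order assms(1) unfolding MLO_order_def metric_linear_order_def by blast
  moreover have "x \<in> mball_of (met M) x \<eta>" "y \<in> mball_of (met M) x \<eta>"
    using assms \<open>\<eta> > 0\<close> by (simp_all add: mdist_self)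
  ultimately have "z \<in> mball_of (met M) x \<eta>"
    using assms unfolding order_convex_def by blast
  then show ?thesis by simp
qed

lemma pint_r_eq:
  "x \<in> univ M \<Longrightarrow> y \<in> univ M \<Longrightarrow>
   pint M r [x, y] = (INF z\<in>{z \<in> univ M. (z, y) \<in> R}. mdist (met M) x z)"
  using order unfolding MLO_order_def by simp

lemma pint_r_le:
  assumes "x \<in> univ M" "y \<in> univ M" "(x, y) \<in> R"
  shows "pint M r [x, y] \<le> 0"
proof -
  have "(INF z\<in>{z \<in> univ M. (z, y) \<in> R}. mdist (met M) x z) \<le> mdist (met M) x x"
    using assms mdist_nonneg
    by (intro cINF_lower bdd_belowI[of _ 0]) auto
  then show ?thesis
    using assms pint_r_eq mdist_self by simp
qed

text \<open>If \<open>y\<close> precedes \<open>x\<close> at distance at least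
  \<open>\<eta>\<close>, then by convexity of balls every \<open>z\<close> below \<open>y\<close> is
  as far from \<open>x\<close>, and so the infimum is at least \<open>\<eta>\<close>.\<close>

lemma pint_r_less:
  assumes "x \<in> univ M" "y \<in> univ M" "pint M r [x, y] < \<eta>"
  shows "(x, y) \<in> R \<or> mdist (met M) x y < \<eta>"
proof (rule ccontr)
  assume *: "\<not> ((x, y) \<in> R \<or> mdist (met M) x y < \<eta>)"
  then have "(y, x) \<in> R"
    using le_linear assms by blast
  have "\<eta> \<le> (INF z\<in>{z \<in> univ M. (z, y) \<in> R}. mdist (met M) x z)"
  proof (rule cINF_greatest)
    show "{z \<in> univ M. (z, y) \<in> R} \<noteq> {}"
      using assms le_refl by blast
    fix z assume "z \<in> {z \<in> univ M. (z, y) \<in> R}"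
    then have "\<not> mdist (met M) x z < \<eta>"
      using * dist_between[of x z y \<eta>] assms \<open>(y, x) \<in> R\<close> by blast
    then show "\<eta> \<le> mdist (met M) x z" by simp
  qed
  then show False
    using assms pint_r_eq by simp
qed

text \<open>Formulas see only the values of \<open>r\<close>, and a small positive value means a
  reversed but close pair; hence the metric error term.\<close>

lemma sep_order:
  assumes "{x, y} \<subseteq> V" "\<eta> > 0"
  shows "sep V (\<lambda>e. (e x, e y) \<in> R) (\<lambda>e. (e x, e y) \<in> R \<or> mdist (met M) (e x) (e y) < \<eta>)"
proof -
  have "sep V (\<lambda>e. feval M e (Pred r [Var x, Var y]) \<le> 0)
     (\<lambda>e. feval M e (Pred r [Var x, Var y]) \<le> \<eta>/2)"
    using assms r_pred by (intro sep_le) auto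
  then show ?thesis
  proof (rule sep_mono)
    fix e assume e: "env e"
    then have "e x \<in> univ M" "e y \<in> univ M" by auto
    then show "(e x, e y) \<in> R \<Longrightarrow> feval M e (Pred r [Var x, Var y]) \<le> 0"
      "feval M e (Pred r [Var x, Var y]) \<le> \<eta>/2 \<Longrightarrow> (e x, e y) \<in> R \<or> mdist (met M) (e x) (e y) < \<eta>"
      using assms by (auto simp: pint_r_le dest: pint_r_less[of _ _ \<eta>])
  qed auto
qed

text \<open>\<open>alt_end f lo hi m x\<close>: there are \<open>x\<^sub>1 \<le> \<dots> \<le> x\<^sub>m = x\<close> with \<open>f x\<^sub>1 \<le> lo\<close>, \<open>f x\<^sub>2 \<ge> hi\<close>,
  \<open>f x\<^sub>3 \<le> lo\<close> and so on.\<close>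

primrec alt_end :: "('m \<Rightarrow> real) \<Rightarrow> real \<Rightarrow> real \<Rightarrow> nat \<Rightarrow> 'm \<Rightarrow> bool" where
  "alt_end f lo hi 0 x \<longleftrightarrow> True"
| "alt_end f lo hi (Suc m) x \<longleftrightarrow> (if even m then f x \<le> lo else hi \<le> f x) \<and>
     (\<exists>y\<in>univ M. alt_end f lo hi m y \<and> (y, x) \<in> R)"

definition alt_below :: "('m \<Rightarrow> real) \<Rightarrow> real \<Rightarrow> real \<Rightarrow> nat \<Rightarrow> 'm \<Rightarrow> bool" where
  "alt_below f lo hi m b \<longleftrightarrow> (\<exists>x\<in>univ M. alt_end f lo hi m x \<and> (x, b) \<in> R)"

lemma alt_end_Suc:
  "alt_end f lo hi (Suc m) x \<longleftrightarrow>
     (if even m then f x \<le> lo else hi \<le> f x) \<and> alt_below f lo hi m x"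
  by (simp add: alt_below_def)

lemma alt_end_mono:
  "lo \<le> lo' \<Longrightarrow> hi' \<le> hi \<Longrightarrow> alt_end f lo hi m x \<Longrightarrow> alt_end f lo' hi' m x"
  by (induction m arbitrary: x) (auto split: if_splits intro: order_trans)

lemma alt_below_mono:
  "lo \<le> lo' \<Longrightarrow> hi' \<le> hi \<Longrightarrow> alt_below f lo hi m x \<Longrightarrow> alt_below f lo' hi' m x"
  unfolding alt_below_def using alt_end_mono by blast

lemma alt_below_0: "x \<in> univ M \<Longrightarrow> alt_below f lo hi 0 x"
  unfolding alt_below_def using le_refl by auto

lemma alt_below_Suc:
  assumes "alt_below f lo hi m x" "x \<in> univ M" "if even m then f x \<le> lo else hi \<le> f x"
  shows "alt_below f lo hi (Suc m) x"
  using assms le_refl alt_end_Suc unfolding alt_below_def by blast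

text \<open>An error in the order relation is absorbed by moving the last point of the alternation,
  as consecutive points of an alternation are far apart.\<close>

lemma alt_below_if_close:
  assumes cont: "\<And>x y. x \<in> univ M \<Longrightarrow> y \<in> univ M \<Longrightarrow> mdist (met M) x y < \<eta> \<Longrightarrow> \<bar>f x - f y\<bar> \<le> \<kappa>"
    and "\<kappa> \<ge> 0" "\<kappa> < hi - lo" "x \<in> univ M" "y \<in> univ M" "alt_end f lo hi m x"
    and "(x, y) \<in> R \<or> mdist (met M) x y < \<eta>"
  shows "alt_below f (lo + \<kappa>) (hi - \<kappa>) m y"
proof (cases "(x, y) \<in> R")
  case True
  then show ?thesis
    using assms alt_end_mono[of lo "lo + \<kappa>" "hi - \<kappa>" hi f m x] unfolding alt_below_def by auto
next
  case False
  \<comment> \<open>\<open>y\<close> lies below \<open>x\<close> and close to it; it will replace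
    \<open>x\<close> as the last point.\<close>
  then have yx: "(y, x) \<in> R" and d: "mdist (met M) x y < \<eta>"
    using assms le_linear by auto
  have f: "\<bar>f x - f y\<bar> \<le> \<kappa>"
    using cont d assms by blast
  show ?thesis
  proof (cases m)
    case 0
    then show ?thesis using alt_below_0 assms by simp
  next
    case (Suc k)
    obtain z where z: "z \<in> univ M" "alt_end f lo hi k z" "(z, x) \<in> R"
      using assms(6) Suc by auto
    \<comment> \<open>If the previous point \<open>z\<close> is above \<open>y\<close>, it lies
      between \<open>y\<close> and \<open>x\<close>, so its value is within \<open>\<kappa>\<close>
      of that of \<open>x\<close>. Consecutive values of an alternation differ by at least
      \<open>hi - lo\<close>, so \<open>k = 0\<close>, where \<open>z\<close> carries no
      condition.\<close>
    have "alt_below f (lo + \<kappa>) (hi - \<kappa>) k y"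
    proof (cases "(z, y) \<in> R")
      case True
      then show ?thesis
        using z assms alt_end_mono[of lo "lo + \<kappa>" "hi - \<kappa>" hi f k z] unfolding alt_below_def by auto
    next
      case False
      then have "mdist (met M) x z < \<eta>"
        using dist_between[of x y z \<eta>] d z le_linear assms by blast
      then have "\<bar>f x - f z\<bar> \<le> \<kappa>"
        using cont z assms by blast
      then have "k = 0"
        using assms(3,6) Suc z(2) by (cases k) (auto split: if_splits)
      then show ?thesis
        using alt_below_0 assms by simp
    qed
    moreover have "if even k then f y \<le> lo + \<kappa> else hi - \<kappa> \<le> f y"
      using assms(6) Suc f by (auto split: if_splits)
    ultimately show ?thesis
      using alt_below_Suc assms Suc by blast
  qed
qed

text \<open>Inclusion of the final segments given by \<open>alt_below\<close>; it is tested on the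
  points that generate the first one.\<close>

definition dominates ::
  "('m \<Rightarrow> real) \<Rightarrow> real \<Rightarrow> real \<Rightarrow> ('m \<Rightarrow> real) \<Rightarrow> real \<Rightarrow> real \<Rightarrow> nat \<Rightarrow> bool" where
  "dominates f lo hi g lo' hi' m \<longleftrightarrow>
     (\<forall>y\<in>univ M. alt_end f lo hi m y \<longrightarrow> alt_below g lo' hi' m y)"

text \<open>Final segments of a linear order are comparable.\<close>

lemma dominates_linear: "dominates f lo hi g lo hi m \<or> dominates g lo hi f lo hi m"
  unfolding dominates_def alt_below_def using le_linear by blast

lemma dominates_mono:
  "dominates f lo hi g lo' hi' m \<Longrightarrow> lo1 \<le> lo \<Longrightarrow> hi \<le> hi1 \<Longrightarrow> lo' \<le> lo1' \<Longrightarrow> hi1' \<le> hi' \<Longrightarrow>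
   dominates f lo1 hi1 g lo1' hi1' m"
  unfolding dominates_def using alt_end_mono alt_below_mono by metis

lemma dominates_alt_below:
  "dominates f lo hi g lo' hi' m \<Longrightarrow> alt_below f lo hi m b \<Longrightarrow> alt_below g lo' hi' m b"
  unfolding dominates_def alt_below_def using le_trans by blast

end

section \<open>Weak o-minimality bounds alternations\<close>

text \<open>A convex set of indices is entered at most once and left at most once.\<close>

lemma card_boundary_convex_le_2:
  fixes S :: "nat set"
  assumes "\<And>i j k. i \<in> S \<Longrightarrow> k \<in> S \<Longrightarrow> i \<le> j \<Longrightarrow> j \<le> k \<Longrightarrow> j \<in> S"
  shows "finite {j. (j \<in> S) \<noteq> (Suc j \<in> S)} \<and> card {j. (j \<in> S) \<noteq> (Suc j \<in> S)} \<le> 2"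
proof -
  let ?D = "{j. (j \<in> S) \<noteq> (Suc j \<in> S)}"
  let ?A = "{j. j \<notin> S \<and> Suc j \<in> S}" and ?B = "{j. j \<in> S \<and> Suc j \<notin> S}"
  have "i = j" if "i \<in> ?A" "j \<in> ?A" for i j
    using that assms[of "Suc i" "Suc j" j] assms[of "Suc j" "Suc i" i] by (cases i j rule: linorder_cases) auto
  then obtain a where "?A \<subseteq> {a}" by blast
  moreover have "i = j" if "i \<in> ?B" "j \<in> ?B" for i j
    using that assms[of i j "Suc i"] assms[of j i "Suc j"] by (cases i j rule: linorder_cases) auto
  then obtain b where "?B \<subseteq> {b}" by blast
  ultimately have "?D \<subseteq> {a, b}" by blast
  then show ?thesis
    using card_mono[of "{a, b}" ?D] finite_subset[of ?D "{a, b}"] by (auto simp: card_insert_if split: if_splits)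
qed

context mlo_structure
begin

text \<open>The point \<open>p 0\<close> precedes the alternation and its value is unconstrained, as
  \<open>alt_end\<close> of length 0 always holds; the alternation proper is \<open>p 1\<close>,
  ..., \<open>p m\<close>.\<close>

lemma alt_end_sequence:
  "alt_end f lo hi m x \<Longrightarrow> x \<in> univ M \<Longrightarrow> \<exists>p :: nat \<Rightarrow> 'm. p m = x \<and> (\<forall>j\<le>m. p j \<in> univ M) \<and>
     (\<forall>j<m. (p j, p (Suc j)) \<in> R \<and> (if even j then f (p (Suc j)) \<le> lo else hi \<le> f (p (Suc j))))"
proof (induction m arbitrary: x)
  case 0
  then show ?case by (intro exI[of _ "\<lambda>_. x"]) simp
next
  case (Suc m)
  then obtain y where y: "y \<in> univ M" "alt_end f lo hi m y" "(y, x) \<in> R" by auto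
  obtain p where p: "p m = y" "\<forall>j\<le>m. p j \<in> univ M"
    "\<forall>j<m. (p j, p (Suc j)) \<in> R \<and> (if even j then f (p (Suc j)) \<le> lo else hi \<le> f (p (Suc j)))"
    using Suc.IH[OF y(2,1)] by blast
  show ?case
    using p y(3) Suc.prems
    by (intro exI[of _ "p(Suc m := x)"]) (auto simp: less_Suc_eq le_Suc_eq)
qed

text \<open>Along an alternation \<open>g\<close> changes at each step, since \<open>f\<close> jumps
  by at least \<open>hi - lo\<close> and \<open>g\<close> is within less than half of that. But
  membership in each of the \<open>k\<close> convex sets changes at most twice along an increasing
  sequence.\<close>

lemma convex_span_alternations:
  assumes g: "g \<in> convex_span (univ M) R"
    and fg: "\<And>x. x \<in> univ M \<Longrightarrow> \<bar>g x - f x\<bar> < (hi - lo)/2"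
  shows "\<exists>N. \<forall>x\<in>univ M. \<not> alt_end f lo hi N x"
proof -
  obtain k c and C :: "nat \<Rightarrow> 'm set" where C: "\<And>i. i < k \<Longrightarrow> order_convex (univ M) R (C i)"
    and g_eq: "g = (\<lambda>x. \<Sum>i<k. c i * indicat_real (C i) x)"
    using g unfolding convex_span_def by blast
  \<comment> \<open>The \<open>N - 1 = 2 * k + 1\<close> jumps are one more than \<open>k\<close>
    convex sets allow.\<close>
  define N where "N = 2 * k + 2"
  have False if x: "x \<in> univ M" "alt_end f lo hi N x" for x
  proof -
    obtain p where p: "\<forall>j\<le>N. p j \<in> univ M" "\<forall>j<N. (p j, p (Suc j)) \<in> R"
      "\<forall>j<N. if even j then f (p (Suc j)) \<le> lo else hi \<le> f (p (Suc j))"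
      using alt_end_sequence[OF x(2,1)] by blast
    have mono: "(p i, p j) \<in> R" if "i \<le> j" "j \<le> N" for i j
      using that
    proof (induction j rule: dec_induct)
      case base
      then show ?case using p(1) le_refl by simp
    next
      case (step j)
      then show ?case using p(2) le_trans by (meson Suc_le_eq Suc_leD)
    qed
    define S where "S i = {j. j \<le> N \<and> p j \<in> C i}" for i
    define D where "D i = {j. (j \<in> S i) \<noteq> (Suc j \<in> S i)}" for i
    have D: "finite (D i) \<and> card (D i) \<le> 2" if "i < k" for i
      unfolding D_def
    proof (rule card_boundary_convex_le_2)
      fix a j b assume *: "a \<in> S i" "b \<in> S i" "a \<le> j" "j \<le> b"
      then have "p a \<in> C i" "p b \<in> C i" "j \<le> N" "p j \<in> univ M" "(p a, p j) \<in> R" "(p j, p b) \<in> R"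
        using p(1) mono[of a j] mono[of j b] by (auto simp: S_def)
      then show "j \<in> S i"
        using C[OF that] unfolding S_def order_convex_def by blast
    qed
    \<comment> \<open>Index 0 is left out because the value of \<open>f\<close> at
      \<open>p 0\<close> is unconstrained.\<close>
    have "{1..<N} \<subseteq> (\<Union>i<k. D i)"
    proof
      fix j assume j: "j \<in> {1..<N}"
      then obtain j' where j': "j = Suc j'" by (cases j) auto
      have "\<bar>g (p j) - f (p j)\<bar> < (hi - lo)/2" "\<bar>g (p (Suc j)) - f (p (Suc j))\<bar> < (hi - lo)/2"
        using fg p(1) j by auto
      moreover have "hi - lo \<le> \<bar>f (p (Suc j)) - f (p j)\<bar>"
        using p(3)[rule_format, of j] p(3)[rule_format, of j'] j j' by (auto split: if_splits)
      ultimately have "g (p j) \<noteq> g (p (Suc j))"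
        by (auto simp: field_simps abs_if split: if_splits)
      moreover have "g (p j) = g (p (Suc j))" if "\<And>i. i < k \<Longrightarrow> (p j \<in> C i) = (p (Suc j) \<in> C i)"
        unfolding g_eq using that by (intro sum.cong) (auto simp: indicator_def)
      ultimately obtain i where "i < k" "(p j \<in> C i) \<noteq> (p (Suc j) \<in> C i)"
        by blast
      then show "j \<in> (\<Union>i<k. D i)"
        using j by (auto simp: D_def S_def)
    qed
    then have "card {1..<N} \<le> card (\<Union>i<k. D i)"
      using D by (intro card_mono) auto
    also have "\<dots> \<le> (\<Sum>i<k. card (D i))"
      by (rule card_UN_le) simp
    also have "\<dots> \<le> (\<Sum>i<k. 2)"
      using D by (intro sum_mono) auto
    finally show False by (simp add: N_def)
  qed
  then show ?thesis by blast
qed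

lemma alternations_bounded:
  assumes "weakly_o_minimal L R M" "definable_pred1 L M f" "lo < hi"
  shows "\<exists>N. \<forall>x\<in>univ M. \<not> alt_end f lo hi N x"
proof -
  obtain g :: "nat \<Rightarrow> 'm \<Rightarrow> real" where g: "\<And>n. g n \<in> convex_span (univ M) R"
    "uniform_limit (univ M) g f sequentially"
    using assms unfolding weakly_o_minimal_def by blast
  have "\<forall>\<^sub>F n in sequentially. \<forall>x\<in>univ M. dist (g n x) (f x) < (hi - lo)/2"
    using g(2) assms(3) by (auto dest!: uniform_limitD[where e = "(hi - lo)/2"])
  then obtain n where "\<forall>x\<in>univ M. dist (g n x) (f x) < (hi - lo)/2"
    using eventually_happens'[OF sequentially_bot] by blast
  then show ?thesis
    using g(1)[of n] by (intro convex_span_alternations[of "g n"]) (auto simp: dist_real_def)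
qed

end

section \<open>Formulas as definable predicates in one variable\<close>

context cl_structure
begin

text \<open>The finitely many free variables outside \<open>X\<close> become a list of parameters
  and those in \<open>X\<close> become variable 0; a constant sequence of formulas then witnesses
  definability.\<close>

lemma definable_pred1_feval:
  assumes "wf_fm L \<phi>" "\<And>v. v \<in> fvars \<phi> - X \<Longrightarrow> e v \<in> univ M"
  shows "definable_pred1 L M (\<lambda>x. feval M (\<lambda>v. if v \<in> X then x else e v) \<phi>)"
proof -
  define vs where "vs = sorted_list_of_set (fvars \<phi> - X)"
  have vs: "set vs = fvars \<phi> - X"
    unfolding vs_def by (simp add: finite_fvars)
  define idx where "idx v = (SOME i. i < length vs \<and> vs ! i = v)" for v
  have idx: "idx v < length vs \<and> vs ! idx v = v" if "v \<in> fvars \<phi> - X" for v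
  proof -
    have "\<exists>i. i < length vs \<and> vs ! i = v"
      using that unfolding vs[symmetric] in_set_conv_nth .
    then show ?thesis
      unfolding idx_def by (rule someI_ex)
  qed
  define \<sigma> where "\<sigma> v = (if v \<in> X then 0 else Suc (idx v))" for v
  define bs where "bs = map e vs"
  have "fm_in L (Suc (length bs)) (rename \<sigma> \<phi>)"
    using wf_rename[OF assms(1)] fvars_rename[of \<sigma> \<phi>] idx
    by (fastforce simp: fm_in_def \<sigma>_def bs_def)
  moreover have "set bs \<subseteq> univ M"
    using vs assms(2) by (auto simp: bs_def)
  moreover have "value_at M (rename \<sigma> \<phi>) (x # bs) = feval M (\<lambda>v. if v \<in> X then x else e v) \<phi>" for x
    unfolding value_at_def feval_rename using idx by (intro feval_cong) (auto simp: \<sigma>_def bs_def)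
  ultimately show ?thesis
    unfolding definable_pred1_def
    by (intro exI[of _ "\<lambda>_. rename \<sigma> \<phi>"] exI[of _ "\<lambda>_. bs"]) (auto simp: uniform_limit_const)
qed

end

section \<open>Alternations of a formula with varying parameters\<close>

text \<open>In \<open>\<phi>\<close> the variables of \<open>X\<close> are identified to a single argument \<open>x\<close>.  The other ones are
  parameters, which an environment provides in two copies: variable \<open>3v + o\<close> holds the value of
  parameter \<open>v\<close> in copy \<open>o \<in> {0, 1}\<close>.  The variables \<open>\<equiv> 2 (mod 3)\<close> remain for quantifiers.\<close>

locale mlo_family = mlo_structure L M r R
  for L :: "('f, 'p) cl_lang" and M :: "('f, 'p, 'm) cl_struct" and r R +
  fixes \<phi> :: "('f, 'p) cl_fm" and X :: "nat set"
  assumes wf: "wf_fm L \<phi>"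
begin

definition section_at :: "nat \<Rightarrow> (nat \<Rightarrow> 'm) \<Rightarrow> 'm \<Rightarrow> real" where
  "section_at j e x = feval M (\<lambda>v. if v \<in> X then x else e (3 * v + j)) \<phi>"

text \<open>The bound is uniform in the parameters given by \<open>e\<close>, so that one formula
  with one error term can serve all of them.\<close>

lemma section_at_uniformly_continuous:
  assumes "\<kappa> > 0"
  obtains \<eta> where "\<eta> > 0" "\<And>j e x y. env e \<Longrightarrow> x \<in> univ M \<Longrightarrow> y \<in> univ M \<Longrightarrow>
    mdist (met M) x y < \<eta> \<Longrightarrow> \<bar>section_at j e x - section_at j e y\<bar> \<le> \<kappa>"
proof -
  have "\<forall>\<^sub>F \<delta> in at_right (0::real). \<delta> > 0 \<and>
      (\<forall>e e'. env_close \<delta> e e' \<longrightarrow> \<bar>feval M e \<phi> - feval M e' \<phi>\<bar> \<le> \<kappa>)"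
    using feval_uniformly_continuous[OF wf assms] eventually_at_right_less by (rule eventually_conj[rotated])
  then obtain \<eta> where \<eta>: "\<eta> > 0"
    "\<And>e e'. env_close \<eta> e e' \<Longrightarrow> \<bar>feval M e \<phi> - feval M e' \<phi>\<bar> \<le> \<kappa>"
    using eventually_happens'[OF trivial_limit_at_right_real] by blast
  have "\<bar>section_at j e x - section_at j e y\<bar> \<le> \<kappa>"
    if "env e" "x \<in> univ M" "y \<in> univ M" "mdist (met M) x y < \<eta>" for j e x y
    unfolding section_at_def using that \<eta>(1)
    by (intro \<eta>(2)) (auto simp: env_close_def image_subset_iff mdist_self)
  with \<eta>(1) show ?thesis by (rule that)
qed

definition params :: "nat \<Rightarrow> nat set" where
  "params j = (\<lambda>v. 3 * v + j) ` (fvars \<phi> - X)"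

text \<open>Variables of residue 2 hold no parameters, so quantifying over them leaves both sections
  alone.\<close>

lemma section_at_upd:
  "j < 2 \<Longrightarrow> z mod 3 = 2 \<Longrightarrow> section_at j (e(z := m)) = section_at j e"
  unfolding section_at_def by (intro ext feval_cong) auto

lemma section_at_rename:
  "section_at j e (e z) = feval M e (rename (\<lambda>v. if v \<in> X then z else 3 * v + j) \<phi>)"
  unfolding section_at_def feval_rename by (rule feval_cong) auto

lemma fvars_section:
  "fvars (rename (\<lambda>v. if v \<in> X then z else 3 * v + j) \<phi>) \<subseteq> insert z (params j)"
  by (rule order_trans[OF fvars_rename]) (auto simp: params_def)

text \<open>The slack in the thresholds is halved: one half goes to the separation of
  \<open>alt_end\<close>, the other pays for the error of \<open>sep_order\<close> by way of
  \<open>alt_below_if_close\<close>. It serves both the induction for \<open>alt_end\<close> and the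
  result for \<open>alt_below\<close>.\<close>

lemma sep_alt_below_if_sep_alt_end:
  assumes IH: "\<And>z lo hi lo' hi'. z mod 3 = 2 \<Longrightarrow> lo < lo' \<Longrightarrow> hi' < hi \<Longrightarrow> lo' < hi' \<Longrightarrow>
      sep (insert z (params j)) (\<lambda>e. alt_end (section_at j e) lo hi m (e z))
        (\<lambda>e. alt_end (section_at j e) lo' hi' m (e z))"
    and "j < 2" "z mod 3 = 2" "lo < lo'" "hi' < hi" "lo' < hi'"
  shows "sep (insert z (params j)) (\<lambda>e. alt_below (section_at j e) lo hi m (e z))
    (\<lambda>e. alt_below (section_at j e) lo' hi' m (e z))"
proof -
  define lo1 where "lo1 = (lo + lo')/2"
  define hi1 where "hi1 = (hi + hi')/2"
  define \<kappa> where "\<kappa> = min (lo' - lo1) (hi1 - hi')"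
  have \<kappa>: "\<kappa> > 0" "lo1 + \<kappa> \<le> lo'" "hi' \<le> hi1 - \<kappa>" "\<kappa> < hi1 - lo1" "lo < lo1" "hi1 < hi" "lo1 < hi1"
    using assms unfolding \<kappa>_def lo1_def hi1_def by (auto simp: min_def field_simps)
  obtain \<eta> where \<eta>: "\<eta> > 0" "\<And>j e x y. env e \<Longrightarrow> x \<in> univ M \<Longrightarrow> y \<in> univ M \<Longrightarrow>
    mdist (met M) x y < \<eta> \<Longrightarrow> \<bar>section_at j e x - section_at j e y\<bar> \<le> \<kappa>"
    using section_at_uniformly_continuous[OF \<kappa>(1)] by blast
  \<comment> \<open>A second variable of residue 2, to be quantified.\<close>
  define z' where "z' = z + 3"
  have z': "z' mod 3 = 2" "z' \<noteq> z"
    using assms by (auto simp: z'_def)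
  have "sep (insert z' (insert z (params j)))
      (\<lambda>e. alt_end (section_at j e) lo hi m (e z') \<and> (e z', e z) \<in> R)
      (\<lambda>e. alt_end (section_at j e) lo1 hi1 m (e z') \<and>
        ((e z', e z) \<in> R \<or> mdist (met M) (e z') (e z) < \<eta>))"
    using \<kappa> z' \<eta>(1)
    by (intro sep_conj sep_order sep_subset[OF IH[of z' lo lo1 hi1 hi]]) auto
  from sep_ex[OF this] show ?thesis
  proof (rule sep_mono)
    fix e assume e: "env e"
    then have ez: "e z \<in> univ M" by auto
    show "alt_below (section_at j e) lo hi m (e z) \<Longrightarrow>
      \<exists>m'\<in>univ M. alt_end (section_at j (e(z' := m'))) lo hi m ((e(z' := m')) z') \<and>
        ((e(z' := m')) z', (e(z' := m')) z) \<in> R"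
      using z'(2) unfolding alt_below_def section_at_upd[OF assms(2) z'(1)] by auto
    assume "\<exists>m'\<in>univ M. alt_end (section_at j (e(z' := m'))) lo1 hi1 m ((e(z' := m')) z') \<and>
      (((e(z' := m')) z', (e(z' := m')) z) \<in> R \<or>
        mdist (met M) ((e(z' := m')) z') ((e(z' := m')) z) < \<eta>)"
    then obtain x where x: "x \<in> univ M" "alt_end (section_at j e) lo1 hi1 m x"
      "(x, e z) \<in> R \<or> mdist (met M) x (e z) < \<eta>"
      using z'(2) unfolding section_at_upd[OF assms(2) z'(1)] by auto
    have "alt_below (section_at j e) (lo1 + \<kappa>) (hi1 - \<kappa>) m (e z)"
      using \<kappa> x ez by (intro alt_below_if_close[OF \<eta>(2)[OF e]]) auto
    then show "alt_below (section_at j e) lo' hi' m (e z)"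
      using \<kappa> alt_below_mono by blast
  qed auto
qed

lemma sep_alt_end:
  assumes "j < 2" "z mod 3 = 2" "lo < lo'" "hi' < hi" "lo' < hi'"
  shows "sep (insert z (params j)) (\<lambda>e. alt_end (section_at j e) lo hi m (e z))
    (\<lambda>e. alt_end (section_at j e) lo' hi' m (e z))"
  using assms(2-)
proof (induction m arbitrary: z lo hi lo' hi')
  case 0
  then show ?case by (simp add: sep_true)
next
  case (Suc m)
  have below: "sep (insert z (params j)) (\<lambda>e. alt_below (section_at j e) lo hi m (e z))
    (\<lambda>e. alt_below (section_at j e) lo' hi' m (e z))"
    by (rule sep_alt_below_if_sep_alt_end[OF Suc.IH assms(1) Suc.prems])
  have "sep (insert z (params j)) (\<lambda>e. section_at j e (e z) \<le> lo) (\<lambda>e. section_at j e (e z) \<le> lo')"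
    "sep (insert z (params j)) (\<lambda>e. hi \<le> section_at j e (e z)) (\<lambda>e. hi' \<le> section_at j e (e z))"
    unfolding section_at_rename
    by (rule sep_le[OF wf_rename[OF wf] fvars_section Suc.prems(2)]
        sep_ge[OF wf_rename[OF wf] fvars_section Suc.prems(3)])+
  with below show ?case
    unfolding alt_end_Suc by (cases "even m") (simp_all add: sep_conj)
qed

lemma sep_alt_below:
  assumes "j < 2" "z mod 3 = 2" "lo < lo'" "hi' < hi" "lo' < hi'"
  shows "sep (insert z (params j)) (\<lambda>e. alt_below (section_at j e) lo hi m (e z))
    (\<lambda>e. alt_below (section_at j e) lo' hi' m (e z))"
  by (rule sep_alt_below_if_sep_alt_end[OF sep_alt_end[OF assms(1)] assms])

text \<open>Domination is the absence of a point with \<open>alt_end\<close> but without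
  \<open>alt_below\<close>. As \<open>alt_end\<close> occurs negatively, its thresholds tighten
  where those of \<open>alt_below\<close> relax.\<close>

lemma sep_dominates:
  assumes "i < 2" "j < 2" "lo1' < lo1" "hi1 < hi1'" "lo1 < hi1" "lo2 < lo2'" "hi2' < hi2" "lo2' < hi2'"
  shows "sep (params i \<union> params j)
    (\<lambda>e. dominates (section_at i e) lo1 hi1 (section_at j e) lo2 hi2 m)
    (\<lambda>e. dominates (section_at i e) lo1' hi1' (section_at j e) lo2' hi2' m)"
proof -
  have E: "sep (insert 2 (params i \<union> params j)) (\<lambda>e. alt_end (section_at i e) lo1' hi1' m (e 2))
    (\<lambda>e. alt_end (section_at i e) lo1 hi1 m (e 2))"
    by (rule sep_subset[OF sep_alt_end[of i 2 lo1' lo1 hi1 hi1']]) (use assms in auto)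
  have B: "sep (insert 2 (params i \<union> params j)) (\<lambda>e. alt_below (section_at j e) lo2 hi2 m (e 2))
    (\<lambda>e. alt_below (section_at j e) lo2' hi2' m (e 2))"
    by (rule sep_subset[OF sep_alt_below[of j 2 lo2 lo2' hi2' hi2]]) (use assms in auto)
  have u: "section_at i (e(2 := m)) = section_at i e" "section_at j (e(2 := m)) = section_at j e" for e m
    using assms(1,2) by (simp_all add: section_at_upd)
  show ?thesis
    using sep_not[OF sep_ex[OF sep_conj[OF E sep_not[OF B]]]]
    by (simp add: u dominates_def)
qed

end

section \<open>Indiscernibility in terms of environments\<close>

text \<open>The source \<open>Inl (k, p)\<close> stands for entry \<open>p\<close> of the \<open>k\<close>-th tuple, \<open>Inr b\<close> for the
  parameter \<open>b\<close>.\<close>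

definition source_val :: "('i \<Rightarrow> 'm list) \<Rightarrow> 'i list \<Rightarrow> nat \<times> nat + 'm \<Rightarrow> 'm" where
  "source_val a us s = (case s of Inl (k, p) \<Rightarrow> a (us ! k) ! p | Inr b \<Rightarrow> b)"

definition sources :: "nat \<Rightarrow> nat \<Rightarrow> 'm set \<Rightarrow> (nat \<times> nat + 'm) set" where
  "sources l n B = Inl ` ({..<l} \<times> {..<n}) \<union> Inr ` B"

text \<open>Variables draw on sources in any order and with repetitions, so arguments can be
  regrouped without renaming the formula.\<close>

definition indisc_env :: "('f, 'p) cl_lang \<Rightarrow> ('f, 'p, 'm) cl_struct \<Rightarrow> nat \<Rightarrow> 'm set \<Rightarrow>
    ('i::linorder) set \<Rightarrow> ('i \<Rightarrow> 'm list) \<Rightarrow> bool" where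
  "indisc_env L M n B J a \<longleftrightarrow>
     (\<forall>\<phi> \<rho> us vs. wf_fm L \<phi> \<and> set us \<subseteq> J \<and> set vs \<subseteq> J \<and> length us = length vs \<and>
        sorted_wrt (<) us \<and> sorted_wrt (<) vs \<and> \<rho> ` fvars \<phi> \<subseteq> sources (length us) n B \<longrightarrow>
        feval M (\<lambda>v. source_val a us (\<rho> v)) \<phi> = feval M (\<lambda>v. source_val a vs (\<rho> v)) \<phi>)"

lemma indisc_envD:
  assumes "indisc_env L M n B J a" "wf_fm L \<phi>" "set us \<subseteq> J" "set vs \<subseteq> J" "length us = length vs"
    and "sorted_wrt (<) us" "sorted_wrt (<) vs" "\<rho> ` fvars \<phi> \<subseteq> sources (length us) n B"
  shows "feval M (\<lambda>v. source_val a us (\<rho> v)) \<phi> = feval M (\<lambda>v. source_val a vs (\<rho> v)) \<phi>"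
  by (rule assms(1)[unfolded indisc_env_def, rule_format]) (intro conjI assms)

lemma length_concat_map_const:
  "\<forall>u\<in>set us. length (a u) = n \<Longrightarrow> length (concat (map a us)) = length us * n"
  by (induction us) auto

lemma nth_concat_map_const:
  "\<forall>u\<in>set us. length (a u) = n \<Longrightarrow> k < length us \<Longrightarrow> p < n \<Longrightarrow>
   concat (map a us) ! (k * n + p) = a (us ! k) ! p"
proof (induction us arbitrary: k)
  case (Cons u us)
  then show ?case by (cases k) (auto simp: nth_append add.assoc)
qed simp

lemma index_less:
  fixes k l p n :: nat
  assumes "k < l" "p < n"
  shows "k * n + p < l * n"
  using assms mult_le_mono1[of "Suc k" l n] by simp

text \<open>The finitely many parameters that occur are listed as \<open>bs\<close>, and the
  variables are renamed to the matching positions in the concatenation.\<close>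

lemma indisc_env_if_indiscernible:
  assumes len: "\<And>i. i \<in> J \<Longrightarrow> length (a i) = n" and ind: "indiscernible L M B J a"
  shows "indisc_env L M n B J a"
  unfolding indisc_env_def
proof (intro allI impI, elim conjE)
  fix \<phi> \<rho> us vs
  assume wf: "wf_fm L \<phi>" and us: "set us \<subseteq> J" "sorted_wrt (<) us" and vs: "set vs \<subseteq> J" "sorted_wrt (<) vs"
    and l: "length us = length vs" and \<rho>: "\<rho> ` fvars \<phi> \<subseteq> sources (length us) n B"
  have "Inr -` (\<rho> ` fvars \<phi>) \<subseteq> B"
    using \<rho> by (auto simp: sources_def)
  moreover have "finite (Inr -` (\<rho> ` fvars \<phi>))"
    by (intro finite_vimageI) (auto simp: finite_fvars)
  ultimately obtain bs where bs: "set bs = Inr -` (\<rho> ` fvars \<phi>)" "set bs \<subseteq> B"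
    using finite_list by metis
  define idx where "idx b = (SOME i. i < length bs \<and> bs ! i = b)" for b
  have idx: "idx b < length bs \<and> bs ! idx b = b" if "b \<in> set bs" for b
    using that unfolding in_set_conv_nth idx_def by (rule someI_ex)
  define \<sigma> where "\<sigma> v = (case \<rho> v of Inl (k, p) \<Rightarrow> k * n + p | Inr b \<Rightarrow> length us * n + idx b)" for v
  have \<sigma>: "\<sigma> v < length us * n + length bs \<and>
      (concat (map a ws) @ bs) ! \<sigma> v = source_val a ws (\<rho> v)"
    if v: "v \<in> fvars \<phi>" and ws: "set ws \<subseteq> J" "length ws = length us" for v ws
  proof (cases "\<rho> v")
    case (Inl kp)
    then obtain k p where kp: "\<rho> v = Inl (k, p)" by (cases kp) auto
    have "Inl (k, p) \<in> sources (length us) n B"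
      using \<rho> v kp by (metis imageI subsetD)
    then have kp': "k < length us" "p < n" by (auto simp: sources_def)
    have "k * n + p < length us * n"
      using kp' by (rule index_less)
    moreover have "\<forall>u\<in>set ws. length (a u) = n"
      using ws len by blast
    ultimately show ?thesis
      using kp kp' ws
      by (simp add: \<sigma>_def source_val_def nth_append length_concat_map_const[of _ _ n]
          nth_concat_map_const)
  next
    case (Inr b)
    then have "b \<in> set bs" using v bs(1) by (metis imageI vimageI)
    moreover have "\<forall>u\<in>set ws. length (a u) = n"
      using ws len by blast
    ultimately show ?thesis
      using Inr ws idx by (simp add: \<sigma>_def source_val_def nth_append length_concat_map_const[of _ _ n])
  qed
  have eq: "value_at M (rename \<sigma> \<phi>) (concat (map a ws) @ bs) = feval M (\<lambda>v. source_val a ws (\<rho> v)) \<phi>"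
    if "set ws \<subseteq> J" "length ws = length us" for ws
    unfolding value_at_def feval_rename using \<sigma> that by (intro feval_cong) simp
  have "length (concat (map a us) @ bs) = length us * n + length bs"
    using us(1) len by (subst length_append, subst length_concat_map_const[of _ _ n]) auto
  moreover have "\<sigma> ` fvars \<phi> \<subseteq> {..<length us * n + length bs}"
    using \<sigma>[OF _ us(1)] by auto
  ultimately have "fm_in L (length (concat (map a us) @ bs)) (rename \<sigma> \<phi>)"
    unfolding fm_in_def using wf_rename[OF wf] order_trans[OF fvars_rename] by simp
  then have "value_at M (rename \<sigma> \<phi>) (concat (map a us) @ bs) =
      value_at M (rename \<sigma> \<phi>) (concat (map a vs) @ bs)"
    by (intro ind[unfolded indiscernible_def, rule_format] conjI us vs l bs(2))
  then show "feval M (\<lambda>v. source_val a us (\<rho> v)) \<phi> = feval M (\<lambda>v. source_val a vs (\<rho> v)) \<phi>"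
    using eq us vs l by simp
qed

text \<open>A position inside the concatenated tuples is decoded into tuple and entry by division
  with remainder by \<open>n\<close>.\<close>

lemma indiscernible_if_indisc_env:
  assumes len: "\<And>i. i \<in> J \<Longrightarrow> length (a i) = n" and ind: "indisc_env L M n B J a"
  shows "indiscernible L M B J a"
  unfolding indiscernible_def
proof (intro allI impI, elim conjE)
  fix \<phi> bs us vs
  assume bs: "set bs \<subseteq> B" and us: "set us \<subseteq> J" "sorted_wrt (<) us"
    and vs: "set vs \<subseteq> J" "sorted_wrt (<) vs" and l: "length us = length vs"
    and fm: "fm_in L (length (concat (map a us) @ bs)) \<phi>"
  define \<rho> where "\<rho> v = (if v < length us * n then Inl (v div n, v mod n)
    else Inr (bs ! (v - length us * n)))" for v
  have len_us: "length (concat (map a us) @ bs) = length us * n + length bs"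
    using us(1) len by (subst length_append, subst length_concat_map_const[of _ _ n]) auto
  have divmod: "v div n < length us" "v mod n < n" if "v < length us * n" for v
    using that by (cases "n = 0"; simp add: less_mult_imp_div_less)+
  have val: "(concat (map a ws) @ bs) ! v = source_val a ws (\<rho> v)"
    if ws: "set ws \<subseteq> J" "length ws = length us" for v ws
  proof -
    have len_ws: "\<forall>u\<in>set ws. length (a u) = n"
      using ws len by blast
    show ?thesis
    proof (cases "v < length us * n")
      case True
      then have "concat (map a ws) ! ((v div n) * n + v mod n) = a (ws ! (v div n)) ! (v mod n)"
        using len_ws ws divmod[OF True] by (intro nth_concat_map_const) auto
      then show ?thesis
        using True ws len_ws
        by (simp add: \<rho>_def source_val_def nth_append length_concat_map_const[of _ _ n])
    next
      case False
      then show ?thesis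
        using ws len_ws
        by (simp add: \<rho>_def source_val_def nth_append length_concat_map_const[of _ _ n])
    qed
  qed
  have eq: "value_at M \<phi> (concat (map a ws) @ bs) = feval M (\<lambda>v. source_val a ws (\<rho> v)) \<phi>"
    if "set ws \<subseteq> J" "length ws = length us" for ws
    unfolding value_at_def by (intro feval_cong val that)
  have "\<rho> v \<in> sources (length us) n B" if "v \<in> fvars \<phi>" for v
  proof (cases "v < length us * n")
    case True
    then show ?thesis using divmod[OF True] by (simp add: \<rho>_def sources_def)
  next
    case False
    have "v < length us * n + length bs"
      using fm that len_us unfolding fm_in_def by auto
    then have "v - length us * n < length bs"
      using False by linarith
    then have "bs ! (v - length us * n) \<in> B"
      using bs nth_mem by blast
    then show ?thesis using False by (simp add: \<rho>_def sources_def)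
  qed
  then have "feval M (\<lambda>v. source_val a us (\<rho> v)) \<phi> = feval M (\<lambda>v. source_val a vs (\<rho> v)) \<phi>"
    using fm us vs l by (intro indisc_envD[OF ind]) (auto simp: fm_in_def)
  then show "value_at M \<phi> (concat (map a us) @ bs) = value_at M \<phi> (concat (map a vs) @ bs)"
    using eq[OF us(1) refl] eq[OF vs(1) l[symmetric]] by simp
qed

text \<open>A formula uses finitely many parameters; hence they can be added one at a time.\<close>

lemma indisc_env_finite_subsets:
  assumes "\<And>B'. finite B' \<Longrightarrow> B' \<subseteq> B \<Longrightarrow> indisc_env L M n B' J a"
  shows "indisc_env L M n B J a"
  unfolding indisc_env_def
proof (intro allI impI, elim conjE)
  fix \<phi> \<rho> us vs
  assume wf: "wf_fm L \<phi>" and us: "set us \<subseteq> J" "sorted_wrt (<) us" and vs: "set vs \<subseteq> J" "sorted_wrt (<) vs"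
    and l: "length us = length vs" and \<rho>: "\<rho> ` fvars \<phi> \<subseteq> sources (length us) n B"
  define B' where "B' = Inr -` (\<rho> ` fvars \<phi>)"
  have "finite B'"
    unfolding B'_def by (intro finite_vimageI) (auto simp: finite_fvars)
  moreover have "B' \<subseteq> B"
    using \<rho> by (auto simp: B'_def sources_def)
  ultimately have "indisc_env L M n B' J a"
    by (rule assms)
  moreover have "\<rho> ` fvars \<phi> \<subseteq> sources (length us) n B'"
  proof
    fix s assume "s \<in> \<rho> ` fvars \<phi>"
    then show "s \<in> sources (length us) n B'"
      using \<rho> by (cases s) (auto simp: sources_def B'_def)
  qed
  ultimately show "feval M (\<lambda>v. source_val a us (\<rho> v)) \<phi> = feval M (\<lambda>v. source_val a vs (\<rho> v)) \<phi>"
    using wf us vs l by (intro indisc_envD)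
qed

lemma indisc_env_mono:
  assumes "indisc_env L M n B J a" "B' \<subseteq> B"
  shows "indisc_env L M n B' J a"
proof -
  have "sources l n B' \<subseteq> sources l n B" for l
    using assms(2) by (auto simp: sources_def)
  note sub = order_trans[OF _ this]
  show ?thesis
    unfolding indisc_env_def[of L M n B']
    by (intro allI impI, elim conjE, rule indisc_envD[OF assms(1)], assumption+, erule sub)
qed

section \<open>Inserting the element at the cut\<close>

text \<open>The step of adding one parameter \<open>b\<close>: \<open>ind\<close> is the induction
  hypothesis for the whole sequence, \<open>ind_b\<close> the given indiscernibility away from the
  cut.\<close>

locale cut_sequence = mlo_structure L M r R
  for L :: "('f, 'p) cl_lang" and M :: "('f, 'p, 'm) cl_struct" and r R +
  fixes I1 I2 :: "('i::linorder) set" and c :: 'i and n :: nat and a :: "'i \<Rightarrow> 'm list"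
    and B :: "'m set" and b :: 'm
  assumes wom: "weakly_o_minimal L R M"
    and I1: "\<And>i. i \<in> I1 \<Longrightarrow> i < c" and I2: "\<And>i. i \<in> I2 \<Longrightarrow> c < i"
    and I1_inf: "I1 \<noteq> {}" "\<And>i. i \<in> I1 \<Longrightarrow> \<exists>j\<in>I1. i < j"
    and I2_inf: "I2 \<noteq> {}" "\<And>i. i \<in> I2 \<Longrightarrow> \<exists>j\<in>I2. j < i"
    and tup: "\<And>i. i \<in> I1 \<union> {c} \<union> I2 \<Longrightarrow> a i \<in> tuples M n"
    and B: "B \<subseteq> univ M" and b: "b \<in> univ M"
    and ind: "indisc_env L M n B (I1 \<union> {c} \<union> I2) a"
    and ind_b: "indisc_env L M n (insert b B) (I1 \<union> I2) a"
begin

lemma source_val_in_univ: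
  assumes "s \<in> sources (length us) n (insert b B)" "set us \<subseteq> I1 \<union> {c} \<union> I2"
  shows "source_val a us s \<in> univ M"
proof (cases s)
  case (Inl kp)
  then obtain k p where kp: "s = Inl (k, p)" by (cases kp) simp
  then have "k < length us" "p < n"
    using assms(1) by (auto simp: sources_def)
  moreover from this have "a (us ! k) \<in> tuples M n"
    using assms(2) nth_mem by (intro tup) blast
  ultimately show ?thesis
    using kp by (auto simp: source_val_def tuples_def)
next
  case (Inr b')
  then show ?thesis
    using assms(1) b B by (auto simp: source_val_def sources_def)
qed

end

text \<open>\<open>i\<close> and \<open>j\<close> are chosen so close to the cut that each of
  \<open>i\<close>, \<open>c\<close>, \<open>j\<close> can stand between \<open>ws\<close> and
  \<open>zs\<close>.\<close>

locale cut_formula = cut_sequence L M r R I1 I2 c n a B b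
  for L :: "('f, 'p) cl_lang" and M :: "('f, 'p, 'm) cl_struct" and r R
    and I1 I2 :: "('i::linorder) set" and c n a B b +
  fixes \<phi> :: "('f, 'p) cl_fm" and \<rho> :: "nat \<Rightarrow> nat \<times> nat + 'm" and ws zs :: "'i list" and i j :: 'i
  assumes wf: "wf_fm L \<phi>"
    and \<rho>: "\<rho> ` fvars \<phi> \<subseteq> sources (Suc (length ws + length zs)) n (insert b B)"
    and ws: "set ws \<subseteq> I1" "sorted_wrt (<) ws" and zs: "set zs \<subseteq> I2" "sorted_wrt (<) zs"
    and i: "i \<in> I1" "\<And>w. w \<in> set ws \<Longrightarrow> w < i" and j: "j \<in> I2" "\<And>z. z \<in> set zs \<Longrightarrow> j < z"
begin

text \<open>Only the variables with source \<open>b\<close> are freed; the others draw on the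
  sequence and \<open>B\<close>, where indiscernibility is known even with \<open>c\<close>.\<close>

definition fibre :: "'i \<Rightarrow> 'm \<Rightarrow> real" where
  "fibre q x = feval M (\<lambda>v. if \<rho> v = Inr b then x else source_val a (ws @ q # zs) (\<rho> v)) \<phi>"

sublocale mlo_family L M r R \<phi> "{v. \<rho> v = Inr b}"
  by unfold_locales (rule wf)

text \<open>The default \<open>b\<close> is the value of variable 2 in particular, which is the
  point argument when \<open>alt_below\<close> is tested at \<open>b\<close>.\<close>

definition pair_env :: "'i \<Rightarrow> 'i \<Rightarrow> nat \<Rightarrow> 'm" where
  "pair_env q q' w =
     (if w \<in> params 0 then source_val a (ws @ q # zs) (\<rho> (w div 3))
      else if w \<in> params 1 then source_val a (ws @ q' # zs) (\<rho> (w div 3)) else b)"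

lemma params_0: "w \<in> params 0 \<Longrightarrow> w mod 3 = 0 \<and> w div 3 \<in> fvars \<phi> \<and> \<rho> (w div 3) \<noteq> Inr b"
  by (auto simp: params_def)

lemma Suc_mult_3_div_3: "Suc (3 * v) div 3 = v"
  by presburger

lemma params_1: "w \<in> params 1 \<Longrightarrow> w mod 3 = 1 \<and> w div 3 \<in> fvars \<phi> \<and> \<rho> (w div 3) \<noteq> Inr b"
  by (auto simp: params_def Suc_mult_3_div_3)

lemma section_at_pair_env:
  "section_at 0 (pair_env q q') = fibre q" "section_at 1 (pair_env q q') = fibre q'"
proof -
  have 0: "3 * v + 0 \<in> params 0" and 1: "3 * v + 1 \<in> params 1"
    if "v \<in> fvars \<phi>" "\<rho> v \<noteq> Inr b" for v
    using that by (auto simp: params_def)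
  have n1: "3 * v + 1 \<notin> params 0" for v
    using params_0[of "3 * v + 1"] by auto
  have "pair_env q q' (3 * v + 0) = source_val a (ws @ q # zs) (\<rho> v)"
    "pair_env q q' (3 * v + 1) = source_val a (ws @ q' # zs) (\<rho> v)"
    if "v \<in> fvars \<phi>" "\<rho> v \<noteq> Inr b" for v
    using 0[OF that] 1[OF that] n1[of v] by (simp_all add: pair_env_def Suc_mult_3_div_3)
  then show "section_at 0 (pair_env q q') = fibre q" "section_at 1 (pair_env q q') = fibre q'"
    unfolding section_at_def fibre_def by (intro ext feval_cong; simp)+
qed

lemma env_pair_env:
  assumes "q \<in> I1 \<union> {c} \<union> I2" "q' \<in> I1 \<union> {c} \<union> I2"
  shows "env (pair_env q q')"
proof -
  have "source_val a (ws @ q # zs) (\<rho> v) \<in> univ M" if "v \<in> fvars \<phi>" "q \<in> I1 \<union> {c} \<union> I2" for v q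
    using \<rho> that ws(1) zs(1) by (intro source_val_in_univ) auto
  then show ?thesis
    using assms b params_0 params_1 unfolding pair_env_def by auto
qed

lemma source_in:
  assumes "v \<in> fvars \<phi>" "\<rho> v \<noteq> Inr b"
  shows "\<rho> v \<in> sources (Suc (length ws + length zs)) n B"
proof -
  have "\<rho> v \<in> sources (Suc (length ws + length zs)) n (insert b B)"
    using \<rho> assms(1) by blast
  then show ?thesis
    using assms(2) by (auto simp: sources_def)
qed

text \<open>In \<open>ws @ [q, q'] @ zs\<close> the first copy of the parameters skips \<open>q'\<close>, the second one \<open>q\<close>.\<close>

lemma feval_pair_env:
  assumes J: "set [q, q', s, s'] \<subseteq> I1 \<union> {c} \<union> I2"
    and sorted: "sorted_wrt (<) (ws @ [q, q'] @ zs)" "sorted_wrt (<) (ws @ [s, s'] @ zs)"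
    and \<psi>: "wf_fm L \<psi>" "fvars \<psi> \<subseteq> params 0 \<union> params 1"
  shows "feval M (pair_env q q') \<psi> = feval M (pair_env s s') \<psi>"
proof -
  \<comment> \<open>\<open>sh o'\<close> jumps over position \<open>length ws + o'\<close> of the
    longer list, which is \<open>q'\<close> for 1 and \<open>q\<close> for 0.\<close>
  define sh where "sh o' t = (case t of Inl (k, p) \<Rightarrow>
      Inl (if k < length ws + o' then k else Suc k, p) | Inr b' \<Rightarrow> Inr b')" for o' and t :: "nat \<times> nat + 'm"
  define \<rho>' where "\<rho>' w = sh (if w mod 3 = 0 then 1 else 0) (\<rho> (w div 3))" for w
  have nth1: "(ws @ [q, q'] @ zs) ! (if k < length ws + 1 then k else Suc k) = (ws @ q # zs) ! k"
    and nth0: "(ws @ [q, q'] @ zs) ! (if k < length ws + 0 then k else Suc k) = (ws @ q' # zs) ! k" for q q' k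
  proof -
    consider "k < length ws" | t where "k = length ws + t"
      using le_Suc_ex not_less by blast
    then show "(ws @ [q, q'] @ zs) ! (if k < length ws + 1 then k else Suc k) = (ws @ q # zs) ! k"
      "(ws @ [q, q'] @ zs) ! (if k < length ws + 0 then k else Suc k) = (ws @ q' # zs) ! k"
      by (cases; simp add: nth_append nth_Cons split: nat.split)+
  qed
  have sh1: "source_val a (ws @ [q, q'] @ zs) (sh 1 t) = source_val a (ws @ q # zs) t" for q q' t
    unfolding sh_def source_val_def using nth1 by (auto split: sum.split prod.split simp del: append.simps)
  have sh0: "source_val a (ws @ [q, q'] @ zs) (sh 0 t) = source_val a (ws @ q' # zs) t" for q q' t
    unfolding sh_def source_val_def using nth0 by (auto split: sum.split prod.split simp del: append.simps)
  have pe: "pair_env q q' w = source_val a (ws @ [q, q'] @ zs) (\<rho>' w)" if "w \<in> fvars \<psi>" for q q' w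
  proof (cases "w \<in> params 0")
    case True
    then show ?thesis
      using params_0[OF True] sh1 by (simp add: pair_env_def \<rho>'_def)
  next
    case False
    then have "w \<in> params 1" using \<psi>(2) that by blast
    then show ?thesis
      using False params_1[of w] sh0 by (simp add: pair_env_def \<rho>'_def)
  qed
  have "\<rho>' w \<in> sources (length (ws @ [q, q'] @ zs)) n B" if "w \<in> fvars \<psi>" for w
  proof -
    have "w \<in> params 0 \<or> w \<in> params 1"
      using that \<psi>(2) by blast
    then have "w div 3 \<in> fvars \<phi>" "\<rho> (w div 3) \<noteq> Inr b"
      using params_0 params_1 by blast+
    then have "\<rho> (w div 3) \<in> sources (Suc (length ws + length zs)) n B"
      by (rule source_in)
    then show ?thesis
      by (auto simp: sources_def \<rho>'_def sh_def)
  qed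
  then have "feval M (\<lambda>w. source_val a (ws @ [q, q'] @ zs) (\<rho>' w)) \<psi> =
      feval M (\<lambda>w. source_val a (ws @ [s, s'] @ zs) (\<rho>' w)) \<psi>"
    using J ws(1) zs(1) by (intro indisc_envD[OF ind \<psi>(1) _ _ _ sorted]) auto
  moreover have "feval M (pair_env q q') \<psi> = feval M (\<lambda>w. source_val a (ws @ [q, q'] @ zs) (\<rho>' w)) \<psi>"
    "feval M (pair_env s s') \<psi> = feval M (\<lambda>w. source_val a (ws @ [s, s'] @ zs) (\<rho>' w)) \<psi>"
    by (intro feval_cong pe; assumption)+
  ultimately show ?thesis by simp
qed

lemma sorted_insert_list:
  assumes "sorted_wrt (<) us" "set us \<subseteq> {i..j}"
  shows "sorted_wrt (<) (ws @ us @ zs)"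
  using assms ws(2) zs(2) i(2) j(2) I1 I2 ws(1) zs(1)
  by (fastforce simp: sorted_wrt_append)

lemma i_c_j: "i < c" "c < j"
  using I1 I2 i j by auto

lemma fibre_b: "fibre q b = feval M (\<lambda>v. source_val a (ws @ q # zs) (\<rho> v)) \<phi>"
  unfolding fibre_def by (rule feval_cong) (auto simp: source_val_def)

text \<open>Here \<open>b\<close> may occur as a parameter, because \<open>i\<close> and
  \<open>j\<close> avoid the cut and \<open>ind_b\<close> applies.\<close>

lemma feval_pair_env_b:
  assumes "q \<in> {i, j}" "q' \<in> {i, j}" and \<psi>: "wf_fm L \<psi>" "fvars \<psi> \<subseteq> insert 2 (params 0)"
  shows "feval M (pair_env q q) \<psi> = feval M (pair_env q' q') \<psi>"
proof -
  define \<rho>' where "\<rho>' w = (if w = 2 then Inr b else \<rho> (w div 3))" for w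
  have n2: "2 \<notin> params 0" "2 \<notin> params 1"
    using params_0[of 2] params_1[of 2] by auto
  have pe: "pair_env q q w = source_val a (ws @ q # zs) (\<rho>' w)" if "w \<in> fvars \<psi>" for q w
    using that \<psi>(2) n2 by (auto simp: pair_env_def \<rho>'_def source_val_def)
  have "\<rho>' w \<in> sources (length (ws @ q # zs)) n (insert b B)" if "w \<in> fvars \<psi>" for w
  proof (cases "w = 2")
    case True
    then show ?thesis by (simp add: \<rho>'_def sources_def)
  next
    case False
    then have "w div 3 \<in> fvars \<phi>"
      using that \<psi>(2) params_0 by blast
    then show ?thesis
      using False \<rho> by (auto simp: \<rho>'_def)
  qed
  then have "feval M (\<lambda>w. source_val a (ws @ q # zs) (\<rho>' w)) \<psi> =
      feval M (\<lambda>w. source_val a (ws @ q' # zs) (\<rho>' w)) \<psi>"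
    using assms(1,2) ws(1) zs(1) i(1) j(1) i_c_j sorted_insert_list[of "[q]"] sorted_insert_list[of "[q']"]
    by (intro indisc_envD[OF ind_b \<psi>(1)]) auto
  moreover have "feval M (pair_env q q) \<psi> = feval M (\<lambda>w. source_val a (ws @ q # zs) (\<rho>' w)) \<psi>"
    "feval M (pair_env q' q') \<psi> = feval M (\<lambda>w. source_val a (ws @ q' # zs) (\<rho>' w)) \<psi>"
    by (intro feval_cong pe; assumption)+
  ultimately show ?thesis by simp
qed

lemma fibre_j_b: "fibre j b = fibre i b"
  unfolding fibre_b
  using ws(1) zs(1) i(1) j(1) i_c_j sorted_insert_list[of "[j]"] sorted_insert_list[of "[i]"] \<rho>
  by (intro indisc_envD[OF ind_b wf]) auto

text \<open>\<open>i\<close> and \<open>j\<close> have the same type over \<open>b\<close> and the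
  other arguments; the slack is the price of separating \<open>alt_below\<close> by a
  formula.\<close>

lemma alt_below_fibre_transfer:
  assumes "q \<in> {i, j}" "q' \<in> {i, j}" "lo < lo'" "hi' < hi" "lo' < hi'"
    and "alt_below (fibre q) lo hi m b"
  shows "alt_below (fibre q') lo' hi' m b"
proof -
  have "2 \<notin> params 0" "2 \<notin> params 1"
    using params_0[of 2] params_1[of 2] by auto
  then have 2: "pair_env q q 2 = b" for q
    by (simp add: pair_env_def)
  have "alt_below (section_at 0 (pair_env q' q')) lo' hi' m (pair_env q' q' 2)"
  proof (rule sep_transfer[OF sep_alt_below[of 0 2 lo lo' hi' hi]])
    show "env (pair_env q q)" "env (pair_env q' q')"
      by (rule env_pair_env; use assms(1,2) i(1) j(1) in blast)+
    show "alt_below (section_at 0 (pair_env q q)) lo hi m (pair_env q q 2)"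
      using assms(6) by (simp only: section_at_pair_env 2)
    show "feval M (pair_env q q) \<psi> = feval M (pair_env q' q') \<psi>"
      if "wf_fm L \<psi>" "fvars \<psi> \<subseteq> insert 2 (params 0)" for \<psi>
      using assms(1,2) that by (rule feval_pair_env_b)
  qed (use assms in simp_all)
  then show ?thesis
    by (simp only: section_at_pair_env 2)
qed

text \<open>Domination does not mention \<open>b\<close>, so \<open>ind\<close> applies to the pairs
  \<open>i\<close>, \<open>c\<close> and \<open>c\<close>, \<open>j\<close> although they contain
  the member at the cut.\<close>

lemma dominates_fibre_transfer:
  assumes "o1 < 2" "o2 < 2" "lo1' < lo1" "hi1 < hi1'" "lo1 < hi1" "lo2 < lo2'" "hi2' < hi2" "lo2' < hi2'"
    and "dominates (section_at o1 (pair_env i c)) lo1 hi1 (section_at o2 (pair_env i c)) lo2 hi2 m"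
  shows "dominates (section_at o1 (pair_env c j)) lo1' hi1' (section_at o2 (pair_env c j)) lo2' hi2' m"
proof (rule sep_transfer[OF sep_dominates[OF assms(1-8)]])
  show "env (pair_env i c)" "env (pair_env c j)"
    by (rule env_pair_env; use i(1) j(1) in simp)+
  fix \<psi> assume \<psi>: "wf_fm L \<psi>" "fvars \<psi> \<subseteq> params o1 \<union> params o2"
  have "fvars \<psi> \<subseteq> params 0 \<union> params 1"
    using \<psi>(2) assms(1,2) by (auto simp: less_2_cases_iff)
  then show "feval M (pair_env i c) \<psi> = feval M (pair_env c j) \<psi>"
    using i_c_j i(1) j(1) \<psi>(1) by (intro feval_pair_env sorted_insert_list) auto
qed (rule assms(9))

text \<open>By indiscernibility the sets of elements above an alternation of length \<open>m\<close> are, up to small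
  changes of \<open>lo\<close> and \<open>hi\<close>, monotone along \<open>i < c < j\<close>.\<close>

lemma alt_below_between:
  assumes "lo < lo'" "hi' < hi" "lo' < hi'"
  shows "alt_below (fibre c) lo hi m b \<Longrightarrow> alt_below (fibre i) lo' hi' m b \<or> alt_below (fibre j) lo' hi' m b"
    and "alt_below (fibre i) lo hi m b \<Longrightarrow> alt_below (fibre j) lo hi m b \<Longrightarrow> alt_below (fibre c) lo' hi' m b"
proof -
  define lo1 where "lo1 = (lo + lo')/2"
  define hi1 where "hi1 = (hi + hi')/2"
  have lv: "lo < lo1" "lo1 < lo'" "hi' < hi1" "hi1 < hi" "lo1 < hi1"
    using assms unfolding lo1_def hi1_def by auto
  have mono: "dominates f lo1 hi1 g lo1 hi1 m \<Longrightarrow> dominates f lo hi g lo' hi' m" for f g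
    by (erule dominates_mono) (use lv in auto)
  \<comment> \<open>Comparability decides the direction between \<open>i\<close> and
    \<open>c\<close>; the transfer forces the same direction between \<open>c\<close> and
    \<open>j\<close>.\<close>
  have "dominates (fibre i) lo1 hi1 (fibre c) lo1 hi1 m \<or> dominates (fibre c) lo1 hi1 (fibre i) lo1 hi1 m"
    by (rule dominates_linear)
  then have "dominates (fibre i) lo hi (fibre c) lo' hi' m \<and> dominates (fibre c) lo hi (fibre j) lo' hi' m \<or>
    dominates (fibre c) lo hi (fibre i) lo' hi' m \<and> dominates (fibre j) lo hi (fibre c) lo' hi' m"
  proof (elim disjE)
    assume d: "dominates (fibre i) lo1 hi1 (fibre c) lo1 hi1 m"
    then have "dominates (section_at 0 (pair_env i c)) lo1 hi1 (section_at 1 (pair_env i c)) lo1 hi1 m"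
      by (simp only: section_at_pair_env)
    then have "dominates (section_at 0 (pair_env c j)) lo hi (section_at 1 (pair_env c j)) lo' hi' m"
      by (rule dominates_fibre_transfer[rotated 8]) (use lv assms in simp_all)
    then show ?thesis
      unfolding section_at_pair_env using mono[OF d] by blast
  next
    assume d: "dominates (fibre c) lo1 hi1 (fibre i) lo1 hi1 m"
    then have "dominates (section_at 1 (pair_env i c)) lo1 hi1 (section_at 0 (pair_env i c)) lo1 hi1 m"
      by (simp only: section_at_pair_env)
    then have "dominates (section_at 1 (pair_env c j)) lo hi (section_at 0 (pair_env c j)) lo' hi' m"
      by (rule dominates_fibre_transfer[rotated 8]) (use lv assms in simp_all)
    then show ?thesis
      unfolding section_at_pair_env using mono[OF d] by blast
  qed
  then show "alt_below (fibre c) lo hi m b \<Longrightarrow> alt_below (fibre i) lo' hi' m b \<or> alt_below (fibre j) lo' hi' m b"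
    "alt_below (fibre i) lo hi m b \<Longrightarrow> alt_below (fibre j) lo hi m b \<Longrightarrow> alt_below (fibre c) lo' hi' m b"
    using dominates_alt_below by blast+
qed

text \<open>One inequality is enough, since the other one is this one for the complement of
  \<open>\<phi>\<close>.\<close>

lemma fibre_c_b_le: "fibre c b \<le> fibre i b"
proof (rule ccontr)
  assume "\<not> fibre c b \<le> fibre i b"
  \<comment> \<open>With a third of the gap, relaxing both thresholds by up to
    \<open>\<gamma>\<close> still keeps low values strictly below high ones.\<close>
  define \<alpha> \<beta> \<gamma> where "\<alpha> = fibre i b" and "\<beta> = fibre c b" and "\<gamma> = (\<beta> - \<alpha>)/3"
  have \<gamma>: "\<gamma> > 0" "\<alpha> + \<gamma> < \<beta> - \<gamma>"
    using \<open>\<not> fibre c b \<le> fibre i b\<close> unfolding \<alpha>_def \<beta>_def \<gamma>_def by (auto simp: field_simps)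
  define A where "A \<epsilon> m q \<longleftrightarrow> alt_below (fibre q) (\<alpha> + \<epsilon>) (\<beta> - \<epsilon>) m b" for \<epsilon> m q
  have mono: "A \<epsilon> m q \<Longrightarrow> \<epsilon> \<le> \<epsilon>' \<Longrightarrow> A \<epsilon>' m q" for \<epsilon> \<epsilon>' m q
    unfolding A_def by (erule alt_below_mono[rotated 2]) auto
  have transfer: "A \<epsilon> m q \<Longrightarrow> q \<in> {i, j} \<Longrightarrow> q' \<in> {i, j} \<Longrightarrow> \<epsilon> < \<epsilon>' \<Longrightarrow> \<epsilon>' \<le> \<gamma> \<Longrightarrow> A \<epsilon>' m q'" for \<epsilon> \<epsilon>' m q q'
    unfolding A_def by (rule alt_below_fibre_transfer) (use \<gamma> in auto)
  have between_c: "A \<epsilon> m c \<Longrightarrow> \<epsilon> < \<epsilon>' \<Longrightarrow> \<epsilon>' \<le> \<gamma> \<Longrightarrow> A \<epsilon>' m i \<or> A \<epsilon>' m j" for \<epsilon> \<epsilon>' m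
    unfolding A_def by (rule alt_below_between(1)) (use \<gamma> in auto)
  have between: "A \<epsilon> m i \<Longrightarrow> A \<epsilon> m j \<Longrightarrow> \<epsilon> < \<epsilon>' \<Longrightarrow> \<epsilon>' \<le> \<gamma> \<Longrightarrow> A \<epsilon>' m c" for \<epsilon> \<epsilon>' m
    unfolding A_def by (rule alt_below_between(2)) (use \<gamma> in auto)
  \<comment> \<open>Each transfer costs slack. The amount \<open>\<epsilon>\<close> may depend on
    \<open>m\<close> but stays strictly below the fixed \<open>\<gamma>\<close>, so there is room
    for further steps.\<close>
  have "\<exists>\<epsilon>. 0 \<le> \<epsilon> \<and> \<epsilon> < \<gamma> \<and> A \<epsilon> m i \<and> A \<epsilon> m c \<and> A \<epsilon> m j" for m
  proof (induction m)
    case 0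
    then show ?case
      using \<gamma> b alt_below_0 unfolding A_def by (intro exI[of _ 0]) auto
  next
    case (Suc m)
    then obtain \<epsilon> where \<epsilon>: "0 \<le> \<epsilon>" "\<epsilon> < \<gamma>" "A \<epsilon> m i" "A \<epsilon> m c" "A \<epsilon> m j" by blast
    define \<epsilon>1 where "\<epsilon>1 = (\<epsilon> + \<gamma>)/2"
    define \<epsilon>2 where "\<epsilon>2 = (\<epsilon>1 + \<gamma>)/2"
    have lv: "\<epsilon> < \<epsilon>1" "\<epsilon>1 < \<epsilon>2" "\<epsilon>2 < \<gamma>" "0 \<le> \<epsilon>2"
      using \<epsilon>(1,2) unfolding \<epsilon>1_def \<epsilon>2_def by auto
    have "A \<epsilon>2 (Suc m) i \<and> A \<epsilon>2 (Suc m) c \<and> A \<epsilon>2 (Suc m) j"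
    proof (cases "even m")
      case True
      \<comment> \<open>The next point must be low, and \<open>b\<close> is low for the fibres at
        \<open>i\<close> and \<open>j\<close>.\<close>
      have "A \<epsilon> (Suc m) i" "A \<epsilon> (Suc m) j"
        using \<epsilon> True b fibre_j_b unfolding A_def by (auto intro!: alt_below_Suc simp: \<alpha>_def)
      moreover from this have "A \<epsilon>1 (Suc m) c"
        using lv by (intro between[of \<epsilon>]) auto
      ultimately show ?thesis
        using lv mono by (meson less_imp_le less_trans)
    next
      case False
      \<comment> \<open>The next point must be high, and \<open>b\<close> is high for the fibre at
        \<open>c\<close>.\<close>
      have "A \<epsilon> (Suc m) c"
        using \<epsilon> False b unfolding A_def by (auto intro!: alt_below_Suc simp: \<beta>_def)
      moreover from this have "A \<epsilon>1 (Suc m) i \<or> A \<epsilon>1 (Suc m) j"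
        using lv by (intro between_c[of \<epsilon>]) auto
      then obtain q where "q \<in> {i, j}" "A \<epsilon>1 (Suc m) q" by blast
      then have "A \<epsilon>2 (Suc m) i" "A \<epsilon>2 (Suc m) j"
        using lv by (auto intro!: transfer[of \<epsilon>1 "Suc m" q _ \<epsilon>2])
      ultimately show ?thesis
        using lv mono by (meson less_imp_le less_trans)
    qed
    then show ?case
      using lv by blast
  qed
  \<comment> \<open>Passing to the fixed slack \<open>\<gamma>\<close> gives thresholds independent
    of \<open>m\<close>, to which the single bound on alternations applies.\<close>
  then have unbounded: "A \<gamma> m i" for m
    using mono less_imp_le by blast
  have "definable_pred1 L M (fibre i)"
  proof -
    have "source_val a (ws @ i # zs) (\<rho> v) \<in> univ M" if "v \<in> fvars \<phi> - {v. \<rho> v = Inr b}" for v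
      using \<rho> that ws(1) zs(1) i(1) by (intro source_val_in_univ) auto
    from definable_pred1_feval[where X = "{v. \<rho> v = Inr b}", OF wf this] show ?thesis
      unfolding fibre_def by simp
  qed
  then obtain N where "\<forall>x\<in>univ M. \<not> alt_end (fibre i) (\<alpha> + \<gamma>) (\<beta> - \<gamma>) N x"
    using alternations_bounded[OF wom _ \<gamma>(2)] by blast
  then show False
    using unbounded[of N] unfolding A_def alt_below_def by blast
qed

end

section \<open>Moving arguments off the cut\<close>

context cut_sequence
begin

lemma ex_above: "finite S \<Longrightarrow> S \<subseteq> I1 \<Longrightarrow> \<exists>i\<in>I1. \<forall>w\<in>S. w < i"
proof (induction S rule: finite_induct)
  case empty
  then show ?case using I1_inf(1) by auto
next
  case (insert x S)
  then obtain k where k: "k \<in> I1" "\<forall>w\<in>S. w < k" by auto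
  have "max x k \<in> I1"
    using k(1) insert.prems by (simp add: max_def)
  then obtain k' where "k' \<in> I1" "max x k < k'"
    using I1_inf(2) by blast
  then show ?case using k by (intro bexI[of _ k']) auto
qed

lemma ex_below: "finite S \<Longrightarrow> S \<subseteq> I2 \<Longrightarrow> \<exists>i\<in>I2. \<forall>w\<in>S. i < w"
proof (induction S rule: finite_induct)
  case empty
  then show ?case using I2_inf(1) by auto
next
  case (insert x S)
  then obtain k where k: "k \<in> I2" "\<forall>w\<in>S. k < w" by auto
  have "min x k \<in> I2"
    using k(1) insert.prems by (simp add: min_def)
  then obtain k' where "k' \<in> I2" "k' < min x k"
    using I2_inf(2) by blast
  then show ?case using k by (intro bexI[of _ k']) auto
qed

text \<open>If \<open>c\<close> occurs, a member \<open>i\<close> just before the cut takes its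
  place. Equality of values follows from \<open>fibre_c_b_le\<close> for \<open>\<phi>\<close> and
  for \<open>1 - \<phi>\<close>.\<close>

lemma feval_move_off_cut:
  assumes wf: "wf_fm L \<phi>" and us: "set us \<subseteq> I1 \<union> {c} \<union> I2" "sorted_wrt (<) us"
    and \<rho>: "\<rho> ` fvars \<phi> \<subseteq> sources (length us) n (insert b B)"
  obtains us' where "set us' \<subseteq> I1 \<union> I2" "sorted_wrt (<) us'" "length us' = length us"
    "feval M (\<lambda>v. source_val a us' (\<rho> v)) \<phi> = feval M (\<lambda>v. source_val a us (\<rho> v)) \<phi>"
proof (cases "c \<in> set us")
  case False
  with us show ?thesis by (intro that[of us]) auto
next
  case True
  then obtain ws zs where us_eq: "us = ws @ c # zs"
    by (meson split_list)
  have ws: "set ws \<subseteq> I1" "sorted_wrt (<) ws" and zs: "set zs \<subseteq> I2" "sorted_wrt (<) zs"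
    using us I1 I2 unfolding us_eq by (fastforce simp: sorted_wrt_append)+
  obtain i where i: "i \<in> I1" "\<And>w. w \<in> set ws \<Longrightarrow> w < i"
    using ex_above[of "set ws"] ws(1) by auto
  obtain j where j: "j \<in> I2" "\<And>z. z \<in> set zs \<Longrightarrow> j < z"
    using ex_below[of "set zs"] zs(1) by auto
  have \<rho>': "\<rho> ` fvars \<phi> \<subseteq> sources (Suc (length ws + length zs)) n (insert b B)"
    using \<rho> by (simp add: us_eq)
  interpret pos: cut_formula L M r R I1 I2 c n a B b \<phi> \<rho> ws zs i j
    by unfold_locales (fact wf \<rho>' ws zs i j)+
  define \<phi>' where "\<phi>' = Conn (\<lambda>xs. 1 - xs ! 0) [\<phi>]"
  have wf': "wf_fm L \<phi>'"
    using wf connective_complement by (simp add: \<phi>'_def)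
  have \<rho>'': "\<rho> ` fvars \<phi>' \<subseteq> sources (Suc (length ws + length zs)) n (insert b B)"
    using \<rho>' by (simp add: \<phi>'_def)
  interpret neg: cut_formula L M r R I1 I2 c n a B b \<phi>' \<rho> ws zs i j
    by unfold_locales (fact wf' \<rho>'' ws zs i j)+
  have "neg.fibre q b = 1 - pos.fibre q b" for q
    unfolding neg.fibre_b pos.fibre_b by (simp add: \<phi>'_def)
  then have eq: "pos.fibre i b = pos.fibre c b"
    using neg.fibre_c_b_le pos.fibre_c_b_le by simp
  show ?thesis
  proof (rule that)
    show "set (ws @ i # zs) \<subseteq> I1 \<union> I2"
      using ws zs i by auto
    show "sorted_wrt (<) (ws @ i # zs)"
      using pos.sorted_insert_list[of "[i]"] pos.i_c_j by simp
    show "feval M (\<lambda>v. source_val a (ws @ i # zs) (\<rho> v)) \<phi> = feval M (\<lambda>v. source_val a us (\<rho> v)) \<phi>"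
      using eq unfolding pos.fibre_b us_eq .
  qed (simp add: us_eq)
qed

text \<open>Both tuples are moved off the cut, where \<open>ind_b\<close> compares them.\<close>

lemma indisc_env_insert: "indisc_env L M n (insert b B) (I1 \<union> {c} \<union> I2) a"
  unfolding indisc_env_def
proof (intro allI impI, elim conjE)
  fix \<phi> \<rho> us vs
  assume wf: "wf_fm L \<phi>" and us: "set us \<subseteq> I1 \<union> {c} \<union> I2" "sorted_wrt (<) us"
    and vs: "set vs \<subseteq> I1 \<union> {c} \<union> I2" "sorted_wrt (<) vs"
    and l: "length us = length vs" and \<rho>: "\<rho> ` fvars \<phi> \<subseteq> sources (length us) n (insert b B)"
  obtain us' where us': "set us' \<subseteq> I1 \<union> I2" "sorted_wrt (<) us'" "length us' = length us"
    "feval M (\<lambda>v. source_val a us' (\<rho> v)) \<phi> = feval M (\<lambda>v. source_val a us (\<rho> v)) \<phi>"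
    by (rule feval_move_off_cut[OF wf us \<rho>])
  obtain vs' where vs': "set vs' \<subseteq> I1 \<union> I2" "sorted_wrt (<) vs'" "length vs' = length vs"
    "feval M (\<lambda>v. source_val a vs' (\<rho> v)) \<phi> = feval M (\<lambda>v. source_val a vs (\<rho> v)) \<phi>"
    by (rule feval_move_off_cut[OF wf vs \<rho>[unfolded l]])
  have "feval M (\<lambda>v. source_val a us' (\<rho> v)) \<phi> = feval M (\<lambda>v. source_val a vs' (\<rho> v)) \<phi>"
    by (rule indisc_envD[OF ind_b wf us'(1) vs'(1) _ us'(2) vs'(2)]) (use us'(3) vs'(3) l \<rho> in simp_all)
  then show "feval M (\<lambda>v. source_val a us (\<rho> v)) \<phi> = feval M (\<lambda>v. source_val a vs (\<rho> v)) \<phi>"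
    using us'(4) vs'(4) by simp
qed

end

theorem theorem7p15:
  fixes L :: "('f, 'p) cl_lang" and r :: 'p and T :: "('f, 'p) cl_fm set"
  assumes "is_lang L" and "is_theory L T"
    and "expands_MLO TYPE('m) L r T"
    and "\<And>(M :: ('f, 'p, 'm) cl_struct) R.
           is_model L T M \<Longrightarrow> MLO_order r M R \<Longrightarrow> weakly_o_minimal L R M"
  shows "distal TYPE('m) TYPE('i::linorder) L T"
  unfolding distal_def
proof (intro allI impI, elim conjE)
  fix M :: "('f, 'p, 'm) cl_struct" and I1 I2 :: "'i set" and c :: 'i and n a B
  assume M: "is_model L T M" and inf: "infinite I1" "infinite I2"
    and I1: "\<forall>i\<in>I1. i < c" "\<forall>i\<in>I1. \<exists>j\<in>I1. i < j"
    and I2: "\<forall>i\<in>I2. c < i" "\<forall>i\<in>I2. \<exists>j\<in>I2. j < i"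
    and tup: "\<forall>i \<in> I1 \<union> {c} \<union> I2. a i \<in> tuples M n" and B: "B \<subseteq> univ M"
    and ind: "indiscernible L M {} (I1 \<union> {c} \<union> I2) a" and ind_B: "indiscernible L M B (I1 \<union> I2) a"
  have r: "r \<in> Preds L" "parity L r = 2"
    using assms(3) unfolding expands_MLO_def by simp_all
  obtain R where R: "MLO_order r M R"
    using assms(3) M unfolding expands_MLO_def by metis
  have wom: "weakly_o_minimal L R M"
    using assms(4) M R .
  have struct: "is_struct L M"
    using M unfolding is_model_def by (rule conjunct1)
  have len: "length (a i) = n" if "i \<in> I1 \<union> {c} \<union> I2" for i
    using tup that by (auto simp: tuples_def)
  have ind0: "indisc_env L M n {} (I1 \<union> {c} \<union> I2) a"
    using len ind by (rule indisc_env_if_indiscernible)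
  have ind_B': "indisc_env L M n B (I1 \<union> I2) a"
    using _ ind_B by (rule indisc_env_if_indiscernible) (auto intro: len)
  \<comment> \<open>Induction on the finite parameter set: indiscernibility of the whole sequence is
    carried along, that off the cut is inherited from \<open>B\<close>.\<close>
  have "indisc_env L M n B' (I1 \<union> {c} \<union> I2) a" if "finite B'" "B' \<subseteq> B" for B'
    using that
  proof (induction B' rule: finite_induct)
    case empty
    show ?case by (rule ind0)
  next
    case (insert b B')
    interpret cut_sequence L M r R I1 I2 c n a B' b
    proof unfold_locales
      show "indisc_env L M n (insert b B') (I1 \<union> I2) a"
        by (rule indisc_env_mono[OF ind_B' insert.prems])
      show "I1 \<noteq> {}" "I2 \<noteq> {}"
        using inf by auto
      show "indisc_env L M n B' (I1 \<union> {c} \<union> I2) a"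
        using insert by simp
    qed (use assms(1) struct r R wom I1 I2 tup B insert.prems in auto)
    show ?case by (rule indisc_env_insert)
  qed
  then have "indisc_env L M n B (I1 \<union> {c} \<union> I2) a"
    by (rule indisc_env_finite_subsets)
  with len show "indiscernible L M B (I1 \<union> {c} \<union> I2) a"
    by (rule indiscernible_if_indisc_env)
qed

end
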